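(* (i) $\mathrm{MC}(\cap,+,/)\in\mathrm{P}$. (ii) $\mathrm{MC}(\cap,+,\times,/)\in\mathrm{E}$, where $\mathrm{E}=\mathrm{DTIME}(2^{O(n)})$.
   Context: Natural numbers include $0$. For $A,B\subseteq\mathbb N$: $A\cup B$, $A\cap B$ are the usual operations, $\overline{A}=\mathbb N\setminus A$, $A+B=\{a+b: a\in A, b\in B\}$, $A\times B=\{a\cdot b: a\in A, b\in B\}$, and $A/B=\{c\in\mathbb N:\exists a\in A\ \exists b\in B\setminus\{0\}: a=c\cdot b\}$ (exact integer division without remainder or rounding). For $\emptyset\ne\mathcal O\subseteq\{\cup,\cap,\overline{\phantom{c}},+,\times,/\}$, an $\mathcal O$-circuit $C=(V,E,g_C,\alpha)$ is a finite acyclic directed multigraph with gate set $V\subseteq\mathbb N$, every gate having indegree $0$, $1$ or $2$, a designated output gate $g_C\in V$, and a labeling $\alpha$: gates of indegree $0$ (input gates) are labeled by natural numbers, gates of indegree $1$ are labeled $\overline{\phantom{c}}$ (allowed only if $\overline{\phantom{c}}\in\mathcal O$), and gates of indegree $2$ are labeled by an operation in $\mathcal O\setminus\{\overline{\phantom{c}}\}$. The result set $I(g)\subseteq\mathbb N$ is defined inductively: $I(g)=\{\alpha(g)\}$ for an input gate; $I(g)=\mathbb N\setminus I(p)$ for a complement gate with predecessor $p$; $I(g)=I(g_1)\,\sigma\,I(g_2)$ for a gate labeled $\sigma$ with predecessors $g_1\le g_2$ (a double edge from one gate gives $g_1=g_2$). $I(C)=I(g_C)$. A circuit is encoded as a bit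 string listing its gates in reverse topological order, each gate as the triple (gate name, label, list of predecessors), with all numbers (including input labels) in binary; $|C|$ denotes the length of this encoding. The membership problem is $\mathrm{MC}(\mathcal O)=\{(C,b): C \text{ is an } \mathcal O\text{-circuit},\ b\in\mathbb N,\ b\in I(C)\}$, with $b$ given in binary; $\mathrm{MC}(\sigma_1,\dots,\sigma_n)$ abbreviates $\mathrm{MC}(\{\sigma_1,\dots,\sigma_n\})$. *)

theory Defs
  imports Main
begin

definition set_plus_nat :: "nat set \<Rightarrow> nat set \<Rightarrow> nat set" where
  "set_plus_nat A B = {a + b | a b. a \<in> A \<and> b \<in> B}"

definition set_times_nat :: "nat set \<Rightarrow> nat set \<Rightarrow> nat set" where
  "set_times_nat A B = {a * b | a b. a \<in> A \<and> b \<in> B}"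

definition set_div_nat :: "nat set \<Rightarrow> nat set \<Rightarrow> nat set" where
  "set_div_nat A B = {c. \<exists>a\<in>A. \<exists>b\<in>B - {0}. a = c * b}"

datatype op = OUnion | OInter | OCompl | OPlus | OTimes | ODiv

datatype label = LInput nat | LOp op

text \<open>A gate: (gate name, label, list of predecessors).\<close>
type_synonym gate = "nat \<times> label \<times> nat list"

text \<open>A circuit: list of gates in reverse topological order (every gate is listed
before its predecessors), together with the designated output gate.\<close>
type_synonym circuit = "gate list \<times> nat"

fun arity :: "op \<Rightarrow> nat" where
  "arity OCompl = 1"
| "arity _ = 2"

fun gate_val :: "label \<Rightarrow> nat set list \<Rightarrow> nat set" where
  "gate_val (LInput k) _ = {k}"
| "gate_val (LOp OCompl) [A] = UNIV - A"
| "gate_val (LOp OUnion) [A, B] = A \<union> B"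
| "gate_val (LOp OInter) [A, B] = A \<inter> B"
| "gate_val (LOp OPlus) [A, B] = set_plus_nat A B"
| "gate_val (LOp OTimes) [A, B] = set_times_nat A B"
| "gate_val (LOp ODiv) [A, B] = set_div_nat A B"
| "gate_val _ _ = {}"

fun gate_set :: "gate list \<Rightarrow> nat \<Rightarrow> nat set" where
  "gate_set [] g = {}"
| "gate_set ((n, l, ps) # rest) g =
     (if g = n then gate_val l (map (gate_set rest) ps) else gate_set rest g)"

definition gate_names :: "gate list \<Rightarrow> nat list" where
  "gate_names gs = map fst gs"

fun gate_ok :: "op set \<Rightarrow> gate list \<Rightarrow> gate \<Rightarrow> bool" where
  "gate_ok Ops rest (n, LInput k, ps) = (ps = [])"
| "gate_ok Ops rest (n, LOp f, ps) =
     (f \<in> Ops \<and> length ps = arity f \<and> sorted ps \<and> (\<forall>p \<in> set ps. p \<in> set (gate_names rest)))"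

fun gates_ok :: "op set \<Rightarrow> gate list \<Rightarrow> bool" where
  "gates_ok Ops [] = True"
| "gates_ok Ops (g # rest) = (gate_ok Ops rest g \<and> gates_ok Ops rest)"

definition is_circuit :: "op set \<Rightarrow> circuit \<Rightarrow> bool" where
  "is_circuit Ops C = (distinct (gate_names (fst C)) \<and> gates_ok Ops (fst C)
                     \<and> snd C \<in> set (gate_names (fst C)))"

definition circuit_set :: "circuit \<Rightarrow> nat set" where
  "circuit_set C = gate_set (fst C) (snd C)"

text \<open>Self-delimiting binary encoding of a natural number: each binary digit b
(least significant first) becomes [False, b]; the number ends with [True, True].\<close>
fun bin_digits :: "nat \<Rightarrow> bool list" where
  "bin_digits n = (if n = 0 then [] else odd n # bin_digits (n div 2))"

definition enc_nat :: "nat \<Rightarrow> bool list" where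
  "enc_nat n = concat (map (\<lambda>b. [False, b]) (bin_digits n)) @ [True, True]"

fun op_code :: "op \<Rightarrow> nat" where
  "op_code OUnion = 0" | "op_code OInter = 1" | "op_code OCompl = 2"
| "op_code OPlus = 3" | "op_code OTimes = 4" | "op_code ODiv = 5"

fun enc_label :: "label \<Rightarrow> bool list" where
  "enc_label (LOp f) = enc_nat (op_code f)"
| "enc_label (LInput k) = enc_nat 6 @ enc_nat k"

fun enc_gate :: "gate \<Rightarrow> bool list" where
  "enc_gate (n, l, ps) = enc_nat n @ enc_label l @ enc_nat (length ps) @ concat (map enc_nat ps)"

definition enc_circuit :: "circuit \<Rightarrow> bool list" where
  "enc_circuit C = enc_nat (snd C) @ enc_nat (length (fst C)) @ concat (map enc_gate (fst C))"

definition MC :: "op set \<Rightarrow> bool list set" where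
  "MC Ops = {enc_circuit C @ enc_nat b | C b. is_circuit Ops C \<and> b \<in> circuit_set C}"

text \<open>Transition function: state, read symbol \<mapsto> (new state, written symbol, head move).
State 0 is initial, 1 accepting, 2 rejecting (both halting). Symbol 0 is blank,
input bit False is symbol 1, True is symbol 2.\<close>
type_synonym tm = "nat \<Rightarrow> nat \<Rightarrow> nat \<times> nat \<times> int"
type_synonym config = "nat \<times> (int \<Rightarrow> nat) \<times> int"

definition valid_tm :: "tm \<Rightarrow> nat \<Rightarrow> nat \<Rightarrow> bool" where
  "valid_tm M k s = (3 \<le> k \<and> 3 \<le> s \<and>
     (\<forall>q<k. \<forall>a<s. fst (M q a) < k \<and> fst (snd (M q a)) < s \<and> snd (snd (M q a)) \<in> {-1, 0, 1}))"

fun tm_step :: "tm \<Rightarrow> config \<Rightarrow> config" where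
  "tm_step M (q, tp, h) =
     (if q = 1 \<or> q = 2 then (q, tp, h)
      else (case M q (tp h) of (q', a, m) \<Rightarrow> (q', tp(h := a), h + m)))"

definition tm_init :: "bool list \<Rightarrow> config" where
  "tm_init x = (0, (\<lambda>i. if 0 \<le> i \<and> i < int (length x) then (if x ! nat i then 2 else 1) else 0), 0)"

definition tm_config :: "tm \<Rightarrow> bool list \<Rightarrow> nat \<Rightarrow> config" where
  "tm_config M x t = (tm_step M ^^ t) (tm_init x)"

definition decides_within :: "tm \<Rightarrow> bool list set \<Rightarrow> (nat \<Rightarrow> nat) \<Rightarrow> bool" where
  "decides_within M L T = (\<forall>x. \<exists>t \<le> T (length x).
      fst (tm_config M x t) \<in> {1, 2} \<and> (fst (tm_config M x t) = 1 \<longleftrightarrow> x \<in> L))"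

definition DTIME :: "(nat \<Rightarrow> nat) \<Rightarrow> bool list set set" where
  "DTIME T = {L. \<exists>M k s. valid_tm M k s \<and> decides_within M L T}"

definition in_P :: "bool list set \<Rightarrow> bool" where
  "in_P L = (\<exists>c. L \<in> DTIME (\<lambda>n. c * (n + 1) ^ c))"

definition in_E :: "bool list set \<Rightarrow> bool" where
  "in_E L = (\<exists>c. L \<in> DTIME (\<lambda>n. 2 ^ (c * (n + 1))))"

end

theory Submission
  imports Defs
begin

text \<open>
  Without union and complement every gate computes the empty set or a singleton, so a circuit can be evaluated
  gate by gate with ordinary binary arithmetic. A gate at depth \<open>d\<close> has a value of \<open>O(n + d)\<close> bits if there is no
  multiplication gate and of \<open>O(n 2^d)\<close> bits otherwise, and everything else is polynomial in this bit length.

  To obtain an actual single-tape Turing machine, evaluation is expressed as a function on binary trees built from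
  pairing, case distinction and bounded iteration. Such a function is realised by a structured program over three
  stacks in which a tree is stored as its prefix code, and the machine keeps one stack per track, which squares
  the running time. The input is parsed without any error handling: the parse result is encoded again and compared
  with the input.
\<close>

section \<open>Stack programs\<close>

text \<open>One argument serves both classes because every bound is polynomial in an abstract
  measure \<open>M\<close>: a multiple of the input length yields P, and a measure of order 2^n
  yields E, since a fixed power of 2^n is still 2^O(n). For E the bit length of values must
  therefore be controlled sharply. Each gate counts one unit, each input label also its bits, and
  the total (\<open>gates_weight\<close>) is at most the input length. A value has at most
  \<open>B\<close> of that weight many bits, where \<open>B\<close> is the identity without
  multiplication and 2^m with it.

  The obstacle in the calculus of computable functions is iteration: polynomially bounded functions
  are not closed under it, even for polynomially many rounds. Hence every rule for loops, folds and
  recursions demands a size bound on all intermediate results.\<close>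

datatype sym = Zero | One | Hash
datatype reg = R0 | R1 | R2

text \<open>Finiteness of \<open>sym\<close> and \<open>reg\<close> makes the tape alphabet
  \<open>cell\<close> and the set of control states of the simulating machine finite.\<close>

instance sym :: finite
proof
  have "(UNIV :: sym set) = {Zero, One, Hash}" by (auto intro: sym.exhaust)
  then show "finite (UNIV :: sym set)" by (metis finite.emptyI finite.insertI)
qed

instance reg :: finite
proof
  have "(UNIV :: reg set) = {R0, R1, R2}" by (auto intro: reg.exhaust)
  then show "finite (UNIV :: reg set)" by (metis finite.emptyI finite.insertI)
qed

datatype com = Skip | Push reg sym | Pop reg | Seq com com
  | If_Top reg "sym option \<Rightarrow> bool" com com | While_Top reg "sym option \<Rightarrow> bool" com

type_synonym store = "reg \<Rightarrow> sym list"

definition top_of :: "sym list \<Rightarrow> sym option" where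
  "top_of xs = (case xs of [] \<Rightarrow> None | a # _ \<Rightarrow> Some a)"

lemma top_of_simps [simp]: "top_of [] = None" "top_of (a # xs) = Some a"
  by (simp_all add: top_of_def)

text \<open>The list of pending commands acts as program counter. Only finitely many such lists are
  reachable (\<open>program_points\<close>), so the list can be part of a machine state.\<close>

fun stp :: "com list \<times> store \<Rightarrow> com list \<times> store" where
  "stp ([], s) = ([], s)"
| "stp (Skip # k, s) = (k, s)"
| "stp (Push r a # k, s) = (k, s(r := a # s r))"
| "stp (Pop r # k, s) = (k, s(r := tl (s r)))"
| "stp (Seq c d # k, s) = (c # d # k, s)"
| "stp (If_Top r P c d # k, s) = ((if P (top_of (s r)) then c else d) # k, s)"
| "stp (While_Top r P c # k, s) = (if P (top_of (s r)) then c # While_Top r P c # k else k, s)"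

text \<open>Quantifying over every continuation \<open>k\<close> makes the relation composable:
  whatever remains to be done can stand behind \<open>c\<close>.\<close>

definition runs :: "com \<Rightarrow> store \<Rightarrow> nat \<Rightarrow> store \<Rightarrow> bool" where
  "runs c s t s' = (\<forall>k. (stp ^^ t) (c # k, s) = (k, s'))"

lemma runs_Skip: "runs Skip s 1 s"
  and runs_Push: "runs (Push r a) s 1 (s(r := a # s r))"
  and runs_Pop: "runs (Pop r) s 1 (s(r := tl (s r)))"
  by (simp_all add: runs_def)

lemma runs_Seq: "runs c s t s' \<Longrightarrow> runs d s' u s'' \<Longrightarrow> runs (Seq c d) s (Suc (t + u)) s''"
  unfolding runs_def by (simp add: funpow_swap1[symmetric] funpow_add add.commute[of t u] del: funpow.simps)
     (simp add: funpow_swap1 funpow_add)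

lemma runs_If: "runs (if P (top_of (s r)) then c else d) s t s' \<Longrightarrow> runs (If_Top r P c d) s (Suc t) s'"
  unfolding runs_def by (auto simp: funpow_swap1)

lemma runs_While_stop: "\<not> P (top_of (s r)) \<Longrightarrow> runs (While_Top r P c) s 1 s"
  by (simp add: runs_def)

lemma runs_While_step:
  assumes "P (top_of (s r))" "runs c s t s'" "runs (While_Top r P c) s' u s''"
  shows "runs (While_Top r P c) s (Suc (t + u)) s''"
  using assms unfolding runs_def
  by (simp add: add.commute[of t u] funpow_swap1 funpow_add)

lemma stp_length: "length (snd (stp (k, s)) r) \<le> Suc (length (s r))"
  by (cases "(k, s)" rule: stp.cases) auto

lemma stps_length: "length (snd ((stp ^^ t) (k, s)) r) \<le> length (s r) + t"
proof (induction t)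
  case (Suc t)
  show ?case using Suc stp_length[of "fst ((stp ^^ t) (k, s))" "snd ((stp ^^ t) (k, s))" r]
    by simp
qed simp

lemma runs_length: "runs c s t s' \<Longrightarrow> length (s' r) \<le> length (s r) + t"
  using stps_length[of t "[c]" s r] by (simp add: runs_def)

text \<open>The continuations that can occur while \<open>c\<close> is executed in front of \<open>k\<close>.\<close>

fun residuals :: "com \<Rightarrow> com list \<Rightarrow> com list set" where
  "residuals (Seq c d) k = insert (Seq c d # k) (residuals c (d # k) \<union> residuals d k)"
| "residuals (If_Top r P c d) k = insert (If_Top r P c d # k) (residuals c k \<union> residuals d k)"
| "residuals (While_Top r P c) k = insert (While_Top r P c # k) (residuals c (While_Top r P c # k))"
| "residuals c k = {c # k}"

lemma finite_residuals: "finite (residuals c k)"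
  by (induction c k rule: residuals.induct) auto

lemma residuals_self: "c # k \<in> residuals c k"
  by (cases c) auto

text \<open>The delicate case is the loop: its body runs in front of the loop itself, so unfolding
  leads back to a list already collected.\<close>

lemma residuals_closed: "x \<in> residuals c k \<Longrightarrow> fst (stp (x, s)) \<in> insert k (residuals c k)"
  by (induction c k rule: residuals.induct) (auto simp: residuals_self split: if_splits)

definition program_points :: "com \<Rightarrow> com list set" where
  "program_points c = insert [] (residuals c [])"

lemma program_points:
  "finite (program_points c)" "[c] \<in> program_points c" "[] \<in> program_points c"
  "x \<in> program_points c \<Longrightarrow> fst (stp (x, s)) \<in> program_points c"
  using finite_residuals[of c "[]"] residuals_self[of c "[]"] residuals_closed[of x c "[]" s]
  by (auto simp: program_points_def)

section \<open>Simulation by a single-tape machine\<close>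

text \<open>Every register occupies one track of the tape, with its top at position 0.
  The Boolean component of a cell marks position 0, where the head rests between two steps of the program.
  A push or pop shifts one whole track and returns to the mark.\<close>

type_synonym cell = "bool \<times> (reg \<Rightarrow> sym option)"

datatype ctl = Start | Accept | Reject | Home "com list" | Back "com list"
  | Shift_Right reg "sym option" "com list" | Find_End reg "com list" | Shift_Left reg "sym option" "com list"

text \<open>In a push, \<open>Shift_Right\<close> carries the displaced symbol along and
  \<open>Back\<close> returns. A pop finds the end first, so that \<open>Shift_Left\<close> can hand
  each symbol to its left neighbour on the way home. \<open>Home []\<close> reads the answer off
  \<open>R0\<close>: the code of \<open>True\<close> starts with \<open>One\<close>, that of
  \<open>False\<close> with \<open>Zero\<close>.\<close>

fun delta :: "com \<Rightarrow> ctl \<Rightarrow> cell \<Rightarrow> ctl \<times> cell \<times> int" where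
  "delta p (Home []) (b, f) = (if f R0 = Some One then Accept else Reject, (b, f), 0)"
| "delta p (Home (Push r a # k)) (b, f) = (Shift_Right r (Some a) k, (b, f), 0)"
| "delta p (Home (Pop r # k)) (b, f) = (Find_End r k, (b, f), 0)"
| "delta p (Home (Skip # k)) (b, f) = (Home k, (b, f), 0)"
| "delta p (Home (Seq c d # k)) (b, f) = (Home (c # d # k), (b, f), 0)"
| "delta p (Home (If_Top r P c d # k)) (b, f) = (Home ((if P (f r) then c else d) # k), (b, f), 0)"
| "delta p (Home (While_Top r P c # k)) (b, f) = (Home (if P (f r) then c # While_Top r P c # k else k), (b, f), 0)"
| "delta p (Shift_Right r v k) (b, f) =
     (if f r = None then (Back k, (b, f(r := v)), 0) else (Shift_Right r (f r) k, (b, f(r := v)), 1))"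
| "delta p (Find_End r k) (b, f) =
     (if f r = None then (Shift_Left r None k, (b, f), 0) else (Find_End r k, (b, f), 1))"
| "delta p (Shift_Left r v k) (b, f) =
     (if b then (Home k, (b, f(r := v)), 0) else (Shift_Left r (f r) k, (b, f(r := v)), -1))"
| "delta p (Back k) (b, f) = (if b then (Home k, (b, f), 0) else (Back k, (b, f), -1))"
| "delta p Start (b, f) = (Home [p], (True, f), 0)"
| "delta p q (b, f) = (q, (b, f), 0)"


fun astep :: "com \<Rightarrow> ctl \<times> (int \<Rightarrow> cell) \<times> int \<Rightarrow> ctl \<times> (int \<Rightarrow> cell) \<times> int" where
  "astep p (q, tp, h) = (if q = Accept \<or> q = Reject then (q, tp, h)
     else (case delta p q (tp h) of (q', a, m) \<Rightarrow> (q', tp(h := a), h + m)))"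

definition track :: "sym list \<Rightarrow> int \<Rightarrow> sym option" where
  "track xs i = (if 0 \<le> i \<and> nat i < length xs then Some (xs ! nat i) else None)"

definition tape :: "(reg \<Rightarrow> int \<Rightarrow> sym option) \<Rightarrow> int \<Rightarrow> cell" where
  "tape w j = (j = 0, \<lambda>r. w r j)"

lemma track_0 [simp]: "track xs 0 = top_of xs"
  by (cases xs) (auto simp: track_def)

lemma track_Nil [simp]: "track [] = (\<lambda>_. None)"
  by (auto simp: track_def)

lemma track_Cons: "0 < i \<Longrightarrow> track (a # xs) i = track xs (i - 1)"
  by (auto simp: track_def nat_diff_distrib nth_Cons' nat_eq_iff)

lemma track_neg: "i < 0 \<Longrightarrow> track xs i = None"
  by (auto simp: track_def)

lemma tape_at: "tape w j = (j = 0, \<lambda>r. w r j)"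
  by (simp add: tape_def)

lemma tape_home: "tape w 0 = (True, \<lambda>r. w r 0)"
  by (simp add: tape_def)

lemma tape_upd: "(tape w)(j := (j = 0, (\<lambda>x. w x j)(r := v))) = tape (w(r := (w r)(j := v)))"
  by (auto simp: tape_def fun_eq_iff)

lemma tape_upd_same: "(tape w)(j := (j = 0, (\<lambda>x. w x j))) = tape w"
  by (auto simp: tape_def fun_eq_iff)

lemma Shift_Right_run:
  assumes "\<And>i. 0 \<le> i \<Longrightarrow> w r (j + i) = track ys i"
  shows "(astep p ^^ Suc (length ys)) (Shift_Right r (Some a) k, tape w, j) =
    (Back k, tape (w(r := (\<lambda>i. if i < j then w r i else track (a # ys) (i - j)))), j + int (length ys))"
  using assms
proof (induction ys arbitrary: a j w)
  case Nil
  have "w r j = None" using Nil[of 0] by simp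
  moreover have "(w r)(j := Some a) = (\<lambda>i. if i < j then w r i else track [a] (i - j))"
  proof
    fix i
    show "((w r)(j := Some a)) i = (if i < j then w r i else track [a] (i - j))"
      using Nil[of "i - j"] by (auto simp: track_Cons)
  qed
  ultimately show ?case using tape_upd[of w j r "Some a"] by (simp add: tape_at[of w j] fun_upd_def)
next
  case (Cons b ys)
  have b: "w r j = Some b" using Cons.prems[of 0] by simp
  let ?w = "w(r := (w r)(j := Some a))"
  have "\<And>i. 0 \<le> i \<Longrightarrow> ?w r (j + 1 + i) = track ys i"
    using Cons.prems[of "1 + _"] by (auto simp: track_Cons ac_simps)
  note IH = Cons.IH[of ?w "j + 1" b, OF this]
  have step: "astep p (Shift_Right r (Some a) k, tape w, j) = (Shift_Right r (Some b) k, tape ?w, j + 1)"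
    using b tape_upd[of w j r "Some a"] by (simp add: tape_at[of w j])
  have e: "(\<lambda>i. if i < j + 1 then ?w r i else track (b # ys) (i - (j + 1))) =
    (\<lambda>i. if i < j then w r i else track (a # b # ys) (i - j))"
  proof
    fix i
    consider "i < j" | "i = j" | "j < i" by linarith
    then show "(if i < j + 1 then ?w r i else track (b # ys) (i - (j + 1))) =
      (if i < j then w r i else track (a # b # ys) (i - j))"
      by cases (auto simp: track_Cons algebra_simps)
  qed
  have "(astep p ^^ Suc (length ys)) (Shift_Right r (Some b) k, tape ?w, j + 1) =
    (Back k, tape (w(r := (\<lambda>i. if i < j then w r i else track (a # b # ys) (i - j)))), j + int (length (b # ys)))"
    using IH unfolding e fun_upd_upd by (simp del: funpow.simps fun_upd_apply)
  then show ?case using step by (simp only: length_Cons funpow_Suc_right[of "Suc (length ys)"] o_apply)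
qed

lemma Back_run: "(astep p ^^ Suc n) (Back k, tape w, int n) = (Home k, tape w, 0)"
proof (induction n)
  case 0
  show ?case using tape_upd_same[of w 0] by (simp add: tape_home)
next
  case (Suc n)
  have "astep p (Back k, tape w, int (Suc n)) = (Back k, tape w, int n)"
    using tape_upd_same[of w "1 + int n"] by (simp add: tape_at[of w "1 + int n"])
  then show ?case using Suc by (metis funpow_Suc_right o_apply)
qed

lemma Find_End_run:
  assumes "\<And>i. 0 \<le> i \<Longrightarrow> w r (j + i) = track ys i"
  shows "(astep p ^^ Suc (length ys)) (Find_End r k, tape w, j) = (Shift_Left r None k, tape w, j + int (length ys))"
  using assms
proof (induction ys arbitrary: j)
  case Nil
  have "w r j = None" using Nil[of 0] by simp
  then show ?case using tape_upd_same[of w j] by (simp add: tape_at[of w j])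
next
  case (Cons b ys)
  have b: "w r j = Some b" using Cons.prems[of 0] by simp
  have "\<And>i. 0 \<le> i \<Longrightarrow> w r (j + 1 + i) = track ys i"
    using Cons.prems[of "1 + _"] by (auto simp: track_Cons ac_simps)
  note IH = Cons.IH[of "j + 1", OF this]
  have "astep p (Find_End r k, tape w, j) = (Find_End r k, tape w, j + 1)"
    using b tape_upd_same[of w j] by (simp add: tape_at[of w j])
  then show ?case using IH by (simp add: funpow_swap1 del: funpow.simps) (simp add: funpow_swap1)
qed

lemma Shift_Left_run:
  "(astep p ^^ Suc n) (Shift_Left r v k, tape w, int n) =
   (Home k, tape (w(r := (\<lambda>i. if 0 \<le> i \<and> i < int n then w r (i + 1) else if i = int n then v else w r i))), 0)"
proof (induction n arbitrary: v w)
  case 0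
  have "(\<lambda>i. if 0 \<le> i \<and> i < int 0 then w r (i + 1) else if i = int 0 then v else w r i) = (w r)(0 := v)"
    by auto
  then show ?case using tape_upd[of w 0 r v] by (simp add: tape_home fun_upd_def)
next
  case (Suc n)
  let ?w = "w(r := (w r)(int (Suc n) := v))"
  have step: "astep p (Shift_Left r v k, tape w, int (Suc n)) = (Shift_Left r (w r (int (Suc n))) k, tape ?w, int n)"
    using tape_upd[of w "1 + int n" r v] by (simp add: tape_at[of w "1 + int n"])
  have e: "(\<lambda>i. if 0 \<le> i \<and> i < int n then ?w r (i + 1) else if i = int n then w r (int (Suc n)) else ?w r i) =
     (\<lambda>i. if 0 \<le> i \<and> i < int (Suc n) then w r (i + 1) else if i = int (Suc n) then v else w r i)"
    by (auto simp: fun_eq_iff ac_simps)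
  have "(astep p ^^ Suc n) (Shift_Left r (w r (int (Suc n))) k, tape ?w, int n) =
   (Home k, tape (w(r := (\<lambda>i. if 0 \<le> i \<and> i < int (Suc n) then w r (i + 1) else if i = int (Suc n) then v else w r i))), 0)"
    using Suc[of "w r (int (Suc n))" ?w] unfolding e fun_upd_upd .
  then show ?case unfolding funpow_Suc_right[of "Suc n"] o_apply step .
qed

definition config_of :: "com list \<times> store \<Rightarrow> ctl \<times> (int \<Rightarrow> cell) \<times> int" where
  "config_of x = (Home (fst x), tape (\<lambda>r. track (snd x r)), 0)"

lemma astep_home:
  assumes "delta p (Home k) (True, \<lambda>r. top_of (s r)) = (q, (True, \<lambda>r. top_of (s r)), 0)"
  shows "astep p (config_of (k, s)) = (q, tape (\<lambda>r. track (s r)), 0)"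
  using assms tape_upd_same[of "\<lambda>r. track (s r)" 0] by (simp add: config_of_def tape_home)

text \<open>For a track with n symbols, a push or pop takes one step to select the operation, n + 1
  steps outward and n + 1 steps back, which gives 2n + 3; every other command takes one
  step.\<close>

lemma simulate_step:
  assumes "k \<noteq> []" "\<And>r. length (s r) \<le> L"
  shows "\<exists>u \<le> 2 * L + 3. (astep p ^^ u) (config_of (k, s)) = config_of (stp (k, s))"
proof -
  have one: "\<exists>u \<le> 2 * L + 3. (astep p ^^ u) (config_of (k, s)) = config_of (stp (k, s))"
    if "delta p (Home k) (True, \<lambda>r. top_of (s r)) = (Home (fst (stp (k, s))), (True, \<lambda>r. top_of (s r)), 0)"
      "snd (stp (k, s)) = s"
    using astep_home[OF that(1)] that(2) by (intro exI[of _ 1]) (simp add: config_of_def)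
  obtain c k' where k: "k = c # k'" using assms(1) by (cases k) auto
  show ?thesis
  proof (cases c)
    case (Push r a)
    let ?w = "\<lambda>r. track (s r)" and ?n = "length (s r)"
    let ?w' = "?w(r := track (a # s r))"
    have w': "(\<lambda>i. if i < 0 then ?w r i else track (a # s r) (i - 0)) = track (a # s r)"
      by (auto simp: track_neg)
    have a1: "astep p (config_of (k, s)) = (Shift_Right r (Some a) k', tape ?w, 0)"
      by (rule astep_home) (simp add: k Push)
    have a2: "(astep p ^^ Suc ?n) (Shift_Right r (Some a) k', tape ?w, 0) = (Back k', tape ?w', int ?n)"
      using Shift_Right_run[of ?w r 0 "s r" p a k'] unfolding w' by simp
    have "(astep p ^^ (Suc ?n + (Suc ?n + 1))) (config_of (k, s)) = (Home k', tape ?w', 0)"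
      unfolding funpow_add o_apply using a1 a2 Back_run[of ?n p k' ?w'] by simp
    moreover have "(\<lambda>x. track ((s(r := a # s r)) x)) = ?w'" by auto
    ultimately show ?thesis using assms(2)[of r]
      by (intro exI[of _ "Suc ?n + (Suc ?n + 1)"]) (simp add: config_of_def k Push)
  next
    case (Pop r)
    let ?w = "\<lambda>r. track (s r)" and ?n = "length (s r)"
    have w': "(\<lambda>i. if 0 \<le> i \<and> i < int ?n then ?w r (i + 1) else if i = int ?n then None else ?w r i) = track (tl (s r))"
      by (cases "s r") (auto simp: track_def fun_eq_iff nat_add_distrib)
    have a1: "astep p (config_of (k, s)) = (Find_End r k', tape ?w, 0)"
      by (rule astep_home) (simp add: k Pop)
    have a2: "(astep p ^^ Suc ?n) (Find_End r k', tape ?w, 0) = (Shift_Left r None k', tape ?w, int ?n)"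
      using Find_End_run[of ?w r 0 "s r" p k'] by simp
    have "(astep p ^^ (Suc ?n + (Suc ?n + 1))) (config_of (k, s)) = (Home k', tape (?w(r := track (tl (s r)))), 0)"
      unfolding funpow_add o_apply using a1 a2 Shift_Left_run[of ?n p r None k' ?w] w' by simp
    moreover have "(\<lambda>x. track ((s(r := tl (s r))) x)) = ?w(r := track (tl (s r)))" by auto
    ultimately show ?thesis using assms(2)[of r]
      by (intro exI[of _ "Suc ?n + (Suc ?n + 1)"]) (simp add: config_of_def k Pop)
  qed (rule one; simp add: k; fail)+
qed

text \<open>After \<open>t\<close> program steps no register is longer than \<open>L + t\<close>, so
  each step costs at most a multiple of that; this is the quadratic slowdown.\<close>

lemma simulate_steps:
  assumes "\<And>r. length (s r) \<le> L"
  shows "\<exists>u \<le> t * (2 * (L + t) + 3). (astep p ^^ u) (config_of (k, s)) = config_of ((stp ^^ t) (k, s))"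
proof (induction t)
  case (Suc t)
  then obtain u where u: "u \<le> t * (2 * (L + t) + 3)" "(astep p ^^ u) (config_of (k, s)) = config_of ((stp ^^ t) (k, s))"
    by blast
  obtain k' s' where ks: "(stp ^^ t) (k, s) = (k', s')" by fastforce
  have len: "length (s' r) \<le> L + t" for r
    using stps_length[of t k s r] assms[of r] ks by simp
  have "\<exists>v \<le> 2 * (L + t) + 3. (astep p ^^ v) (config_of (k', s')) = config_of (stp (k', s'))"
  \<comment> \<open>A finished program is stationary under \<open>stp\<close>, whereas the machine
    would move on from \<open>Home []\<close> to its verdict; so it must make no step here.\<close>
  proof (cases "k' = []")
    case True
    then show ?thesis by (intro exI[of _ 0]) simp
  qed (use simulate_step len in blast)
  then obtain v where v: "v \<le> 2 * (L + t) + 3" "(astep p ^^ v) (config_of (k', s')) = config_of (stp (k', s'))"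
    by blast
  have "v + u \<le> Suc t * (2 * (L + Suc t) + 3)"
    using u(1) v(1) by (simp add: algebra_simps)
  moreover have "(astep p ^^ (v + u)) (config_of (k, s)) = config_of ((stp ^^ Suc t) (k, s))"
    using u(2) v(2) ks by (simp add: funpow_add)
  ultimately show ?case by blast
qed (intro exI[of _ 0], simp)

definition input_store :: "bool list \<Rightarrow> store" where
  "input_store x = (\<lambda>_. [])(R0 := map (\<lambda>b. if b then One else Zero) x)"

lemma simulate_run:
  assumes "runs p (input_store x) t s" and "n = length x"
  shows "\<exists>u \<le> t * (2 * (n + t) + 3) + 2. \<exists>tp h. (astep p ^^ u) (Start, (\<lambda>i. (False, \<lambda>r. track (input_store x r) i)), 0)
    = (if top_of (s R0) = Some One then Accept else Reject, tp, h)"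
proof -
  let ?w = "\<lambda>r. track (input_store x r)"
  have start: "astep p (Start, (\<lambda>i. (False, \<lambda>r. ?w r i)), 0) = config_of ([p], input_store x)"
    by (auto simp: config_of_def tape_def fun_eq_iff)
  have "length (input_store x r) \<le> n" for r using assms(2) by (simp add: input_store_def)
  then obtain u where u: "u \<le> t * (2 * (n + t) + 3)"
    "(astep p ^^ u) (config_of ([p], input_store x)) = config_of ((stp ^^ t) ([p], input_store x))"
    using simulate_steps by blast
  have fin: "(stp ^^ t) ([p], input_store x) = ([], s)" using assms(1) by (simp add: runs_def)
  have "astep p (config_of ([], s)) = (if top_of (s R0) = Some One then Accept else Reject, tape (\<lambda>r. track (s r)), 0)"
    by (rule astep_home) simp
  \<comment> \<open>The two extra steps are the one from \<open>Start\<close>, which sets the mark,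
    and the one from \<open>Home []\<close> to the verdict.\<close>
  with u(2) fin start have "(astep p ^^ (1 + (u + 1))) (Start, (\<lambda>i. (False, \<lambda>r. ?w r i)), 0)
    = (if top_of (s R0) = Some One then Accept else Reject, tape (\<lambda>r. track (s r)), 0)"
    unfolding funpow_add o_apply by simp
  then show ?thesis using u(1) by (intro exI[of _ "1 + (u + 1)"]) auto
qed


section \<open>Numbering the states and symbols of the simulating machine\<close>

lemma finite_numbering:
  assumes "finite S" "distinct [a, b, c]"
  obtains e :: "'a \<Rightarrow> nat" and n where "inj_on e S" "\<And>x. x \<in> S \<Longrightarrow> e x < n" "3 \<le> n" "e a = 0" "e b = 1" "e c = 2"
proof -
  obtain g :: "'a \<Rightarrow> nat" and m where g: "g ` S = {i. i < m}" "inj_on g S"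
    using finite_imp_inj_to_nat_seg[OF assms(1)] by metis
  \<comment> \<open>The machine model reserves 0, 1, 2 for three states and for blank and the two
    input bits, so all other elements are moved up by 3.\<close>
  define e where "e x = (if x = a then 0 else if x = b then 1 else if x = c then 2 else g x + 3)" for x
  show thesis
  proof (rule that[of e "m + 3"])
    show "inj_on e S" using g(2) by (auto simp: inj_on_def e_def split: if_splits)
    show "e x < m + 3" if "x \<in> S" for x using that g(1) by (auto simp: e_def)
  qed (use assms(2) in \<open>auto simp: e_def\<close>)
qed

definition control_states :: "com \<Rightarrow> ctl set" where
  "control_states p = {Start, Accept, Reject} \<union> (\<Union>k \<in> program_points p. {Home k, Back k}
     \<union> (\<Union>r v. {Shift_Right r v k, Shift_Left r v k, Find_End r k}))"

lemma finite_control_states: "finite (control_states p)"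
  unfolding control_states_def using program_points(1) by auto

lemma control_states_simps [simp]:
  "Start \<in> control_states p" "Accept \<in> control_states p" "Reject \<in> control_states p"
  "Home k \<in> control_states p \<longleftrightarrow> k \<in> program_points p"
  "Back k \<in> control_states p \<longleftrightarrow> k \<in> program_points p"
  "Shift_Right r v k \<in> control_states p \<longleftrightarrow> k \<in> program_points p"
  "Shift_Left r v k \<in> control_states p \<longleftrightarrow> k \<in> program_points p"
  "Find_End r k \<in> control_states p \<longleftrightarrow> k \<in> program_points p"
  by (auto simp: control_states_def)

lemma delta_closed:
  assumes "q \<in> control_states p"
  shows "fst (delta p q c) \<in> control_states p" "snd (snd (delta p q c)) \<in> {-1, 0, 1}"
proof -
  obtain b f where c: "c = (b, f)" by fastforce
  \<comment> \<open>Any cell content consists of the top symbols of some store, so the closure of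
    \<open>program_points\<close> under \<open>stp\<close> carries over to \<open>delta\<close> in
    the states \<open>Home\<close>.\<close>
  have "\<exists>s :: store. f = (\<lambda>r. top_of (s r))"
    by (rule exI[of _ "\<lambda>r. case f r of None \<Rightarrow> [] | Some a \<Rightarrow> [a]"]) (auto simp: fun_eq_iff split: option.split)
  then obtain s :: store where f: "f = (\<lambda>r. top_of (s r))" by blast
  have "fst (delta p q (b, f)) \<in> control_states p \<and> snd (snd (delta p q (b, f))) \<in> {-1, 0, 1}"
  proof (cases q)
    case (Home k)
    then show ?thesis using assms program_points(4)[of k p s] f
      by (cases "(k, s)" rule: stp.cases) auto
  qed (use assms program_points(2) in auto)
  then show "fst (delta p q c) \<in> control_states p" "snd (snd (delta p q c)) \<in> {-1, 0, 1}"
    using c by auto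
qed

lemma DTIME_by_program:
  assumes "\<And>x. \<exists>t s. runs p (input_store x) t s \<and> t \<le> T (length x) \<and> (top_of (s R0) = Some One \<longleftrightarrow> x \<in> L)"
  shows "L \<in> DTIME (\<lambda>n. T n * (2 * (n + T n) + 3) + 2)"
proof -
  let ?S = "control_states p"
  obtain eq :: "ctl \<Rightarrow> nat" and kk :: nat where eq: "inj_on eq ?S" "\<And>x. x \<in> ?S \<Longrightarrow> eq x < kk" "3 \<le> kk" "eq Start = 0" "eq Accept = 1" "eq Reject = 2"
    using finite_numbering[OF finite_control_states, of Start Accept Reject] by auto
  let ?c = "\<lambda>v. (False, (\<lambda>_. None)(R0 := v)) :: cell"
  have "?c None \<noteq> ?c (Some Zero)" "?c (Some Zero) \<noteq> ?c (Some One)" "?c None \<noteq> ?c (Some One)"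
    by (metis fun_upd_eqD option.distinct(1) option.inject sym.distinct(1) prod.inject)+
  then have "distinct [?c None, ?c (Some Zero), ?c (Some One)]" by simp
  then obtain ea :: "cell \<Rightarrow> nat" and ss :: nat where ea: "inj ea" "\<And>x. ea x < ss" "3 \<le> ss" "ea (?c None) = 0" "ea (?c (Some Zero)) = 1" "ea (?c (Some One)) = 2"
    using finite_numbering[of UNIV "?c None" "?c (Some Zero)" "?c (Some One)"] by (metis UNIV_I finite)
  \<comment> \<open>\<open>valid_tm\<close> constrains \<open>M\<close> at every number below the
    bounds, also at those that code no control state; these get a harmless default.\<close>
  define M :: tm where "M q a = (if q \<in> eq ` ?S then (case delta p (inv_into ?S eq q) (inv ea a) of
     (q', a', m) \<Rightarrow> (eq q', ea a', m)) else (0, 0, 0))" for q a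
  have M: "M (eq q) (ea a) = (case delta p q a of (q', a', m) \<Rightarrow> (eq q', ea a', m))" if "q \<in> ?S" for q a
    using that eq(1) ea(1) by (simp add: M_def)
  have valid: "valid_tm M kk ss"
    unfolding valid_tm_def
  proof (intro conjI allI impI eq(3) ea(3))
    fix q a assume "q < kk" "a < ss"
    have "fst (M q a) < kk \<and> fst (snd (M q a)) < ss \<and> snd (snd (M q a)) \<in> {-1, 0, 1}"
    proof (cases "q \<in> eq ` ?S")
      case True
      then have "inv_into ?S eq q \<in> ?S" by (rule inv_into_into)
      from delta_closed[OF this, of "inv ea a"] show ?thesis using True eq(2) ea(2)
        by (cases "delta p (inv_into ?S eq q) (inv ea a)") (simp add: M_def)
    next
      case False
      then have "M q a = (0, 0, 0)" by (simp add: M_def)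
      then show ?thesis using eq(3) ea(3) by simp
    qed
    then show "fst (M q a) < kk" "fst (snd (M q a)) < ss" "snd (snd (M q a)) \<in> {-1, 0, 1}" by blast+
  qed
  let ?E = "\<lambda>(q, tp, h). (eq q, (\<lambda>i. ea (tp i)), h :: int)"
  have step: "tm_step M (?E x) = ?E (astep p x) \<and> fst (astep p x) \<in> ?S" if "fst x \<in> ?S" for x
  proof -
    obtain q tp h where x: "x = (q, tp, h)" by (cases x) auto
    have q: "q \<in> ?S" using that x by simp
    have h: "eq q = 1 \<or> eq q = 2 \<longleftrightarrow> q = Accept \<or> q = Reject"
      using inj_onD[OF eq(1) _ q, of Accept] inj_onD[OF eq(1) _ q, of Reject] eq(5,6) by auto
    obtain q' a' m where d: "delta p q (tp h) = (q', a', m)" by (cases "delta p q (tp h)") auto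
    show ?thesis using h q x d M[OF q, of "tp h"] delta_closed(1)[OF q, of "tp h"]
      by (auto simp: fun_eq_iff)
  qed
  have steps: "(tm_step M ^^ u) (?E x) = ?E ((astep p ^^ u) x) \<and> fst ((astep p ^^ u) x) \<in> ?S" if "fst x \<in> ?S" for x u
    using that step by (induction u) auto
  have init: "tm_init x = ?E (Start, (\<lambda>i. (False, \<lambda>r. track (input_store x r) i)), 0)" for x
  proof -
    have "(if 0 \<le> i \<and> i < int (length x) then (if x ! nat i then 2 else 1) else 0) =
      ea (False, \<lambda>r. track (input_store x r) i)" for i :: int
    proof -
      have c: "(\<lambda>r. track (input_store x r) i) = (\<lambda>_. None)(R0 := track (map (\<lambda>b. if b then One else Zero) x) i)"
        by (auto simp: input_store_def fun_eq_iff)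
      show ?thesis unfolding c using ea(4-6) by (auto simp: track_def nat_less_iff)
    qed
    then show ?thesis by (simp add: tm_init_def eq(4))
  qed
  have "decides_within M L (\<lambda>n. T n * (2 * (n + T n) + 3) + 2)"
    unfolding decides_within_def
  proof
    fix x
    obtain t s where t: "runs p (input_store x) t s" "t \<le> T (length x)" "top_of (s R0) = Some One \<longleftrightarrow> x \<in> L"
      using assms by blast
    obtain u tp h where u: "u \<le> t * (2 * (length x + t) + 3) + 2"
      "(astep p ^^ u) (Start, (\<lambda>i. (False, \<lambda>r. track (input_store x r) i)), 0)
        = (if top_of (s R0) = Some One then Accept else Reject, tp, h)"
      using simulate_run[OF t(1) refl] by blast
    have "fst (tm_config M x u) = eq (if top_of (s R0) = Some One then Accept else Reject)"
      unfolding tm_config_def init using steps[of "(Start, (\<lambda>i. (False, \<lambda>r. track (input_store x r) i)), 0)" u] u(2)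
      by simp
    then have "fst (tm_config M x u) \<in> {1, 2} \<and> (fst (tm_config M x u) = 1 \<longleftrightarrow> x \<in> L)"
      using t(3) eq(5,6) by auto
    moreover have "u \<le> T (length x) * (2 * (length x + T (length x)) + 3) + 2"
      using u(1) t(2) by (meson add_mono le_refl mult_le_mono order_trans)
    ultimately show "\<exists>t \<le> T (length x) * (2 * (length x + T (length x)) + 3) + 2.
      fst (tm_config M x t) \<in> {1, 2} \<and> (fst (tm_config M x t) = 1 \<longleftrightarrow> x \<in> L)" by blast
  qed
  with valid show ?thesis unfolding DTIME_def by blast
qed

section \<open>Polynomially bounded functions\<close>

text \<open>With a base of at least 2, constants and sums are absorbed by raising the exponent, so a
  single \<open>k\<close> stands for a whole polynomial.\<close>

definition poly_bounded :: "('a \<Rightarrow> nat) \<Rightarrow> ('a \<Rightarrow> nat) \<Rightarrow> bool" where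
  "poly_bounded M g = (\<exists>k. \<forall>x. g x \<le> (M x + 2) ^ k)"

named_theorems pb_intros

lemma pb_le: "poly_bounded M h \<Longrightarrow> (\<And>x. g x \<le> h x) \<Longrightarrow> poly_bounded M g"
  unfolding poly_bounded_def by (meson order_trans)

lemma pb_self [pb_intros]: "poly_bounded M M"
  unfolding poly_bounded_def by (intro exI[of _ 1]) auto

lemma pb_const [pb_intros]: "poly_bounded M (\<lambda>_. c)"
  unfolding poly_bounded_def
proof (intro exI[of _ c] allI)
  fix x
  have "c \<le> 2 ^ c" by (simp add: less_imp_le)
  also have "\<dots> \<le> (M x + 2) ^ c" by (intro power_mono) auto
  finally show "c \<le> (M x + 2) ^ c" .
qed

lemma pb_mult [pb_intros]:
  assumes "poly_bounded M g" "poly_bounded M h"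
  shows "poly_bounded M (\<lambda>x. g x * h x)"
proof -
  obtain i j where "\<And>x. g x \<le> (M x + 2) ^ i" "\<And>x. h x \<le> (M x + 2) ^ j"
    using assms unfolding poly_bounded_def by blast
  then show ?thesis unfolding poly_bounded_def
    by (intro exI[of _ "i + j"]) (simp add: power_add mult_le_mono)
qed

lemma pb_add [pb_intros]:
  assumes "poly_bounded M g" "poly_bounded M h"
  shows "poly_bounded M (\<lambda>x. g x + h x)"
proof -
  obtain i j where ij: "\<And>x. g x \<le> (M x + 2) ^ i" "\<And>x. h x \<le> (M x + 2) ^ j"
    using assms unfolding poly_bounded_def by blast
  have "g x + h x \<le> (M x + 2) ^ Suc (i + j)" for x
  proof -
    have "g x \<le> (M x + 2) ^ (i + j)" "h x \<le> (M x + 2) ^ (i + j)"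
      by (rule order_trans[OF ij(1)] order_trans[OF ij(2)]; intro power_increasing; simp)+
    then have "g x + h x \<le> 2 * (M x + 2) ^ (i + j)" by simp
    also have "\<dots> \<le> (M x + 2) ^ Suc (i + j)" by simp
    finally show ?thesis .
  qed
  then show ?thesis unfolding poly_bounded_def by blast
qed

lemma pb_Suc [pb_intros]: "poly_bounded M g \<Longrightarrow> poly_bounded M (\<lambda>x. Suc (g x))"
  using pb_add[OF _ pb_const[of M 1]] by simp

lemma pb_power [pb_intros]: "poly_bounded M g \<Longrightarrow> poly_bounded M (\<lambda>x. g x ^ k)"
  by (induction k) (auto intro: pb_intros)

lemma pb_comp:
  assumes "poly_bounded N g" "poly_bounded M (\<lambda>x. N (h x))"
  shows "poly_bounded M (\<lambda>x. g (h x))"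
proof -
  obtain k where "\<And>x. g x \<le> (N x + 2) ^ k" using assms(1) unfolding poly_bounded_def by blast
  then show ?thesis using pb_power[OF pb_add[OF assms(2) pb_const[of M 2]], of k] by (blast intro: pb_le)
qed

declare One_nat_def [simp del]

section \<open>Trees and the stack programs that manipulate them\<close>

datatype tree = Leaf | Node tree tree

fun code :: "tree \<Rightarrow> sym list" where
  "code Leaf = [Zero]"
| "code (Node a b) = One # code a @ code b"

lemma Hash_notin_code [simp]: "Hash \<notin> set (code t)"
  by (induction t) auto

definition exec :: "com \<Rightarrow> store \<Rightarrow> nat \<Rightarrow> store \<Rightarrow> bool" where
  "exec c s T s' = (\<exists>t \<le> T. runs c s t s')"

lemma exec_mono: "exec c s T s' \<Longrightarrow> T \<le> T' \<Longrightarrow> exec c s T' s'"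
  unfolding exec_def using order_trans by blast

lemma exec_Seq: "exec c s T s' \<Longrightarrow> exec d s' U s'' \<Longrightarrow> exec (Seq c d) s (Suc (T + U)) s''"
  unfolding exec_def by (meson runs_Seq add_mono Suc_le_mono)

lemma exec_If: "exec (if P (top_of (s r)) then c else d) s T s' \<Longrightarrow> exec (If_Top r P c d) s (Suc T) s'"
  unfolding exec_def by (meson runs_If Suc_le_mono)

lemma exec_While_stop: "\<not> P (top_of (s r)) \<Longrightarrow> exec (While_Top r P c) s 1 s"
  unfolding exec_def using runs_While_stop by blast

lemma exec_While_step:
  "P (top_of (s r)) \<Longrightarrow> exec c s T s' \<Longrightarrow> exec (While_Top r P c) s' U s'' \<Longrightarrow>
   exec (While_Top r P c) s (Suc (T + U)) s''"
  unfolding exec_def by (meson runs_While_step add_mono Suc_le_mono)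

definition store3 :: "sym list \<Rightarrow> sym list \<Rightarrow> sym list \<Rightarrow> store" where
  "store3 a b c = (\<lambda>r. case r of R0 \<Rightarrow> a | R1 \<Rightarrow> b | R2 \<Rightarrow> c)"

lemma store3_simps [simp]:
  "store3 a b c R0 = a" "store3 a b c R1 = b" "store3 a b c R2 = c"
  "(store3 a b c)(R0 := x) = store3 x b c"
  "(store3 a b c)(R1 := x) = store3 a x c"
  "(store3 a b c)(R2 := x) = store3 a b x"
  by (auto simp: store3_def fun_eq_iff split: reg.split)

lemma exec_Skip: "exec Skip s 1 s"
  and exec_Push: "exec (Push r a) s 1 (s(r := a # s r))"
  and exec_Pop: "exec (Pop r) s 1 (s(r := tl (s r)))"
  unfolding exec_def using runs_Skip runs_Push runs_Pop by blast+

lemma exec_Push3: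
  "exec (Push R0 x) (store3 a b c) 1 (store3 (x # a) b c)"
  "exec (Push R1 x) (store3 a b c) 1 (store3 a (x # b) c)"
  "exec (Push R2 x) (store3 a b c) 1 (store3 a b (x # c))"
  using exec_Push[of _ x "store3 a b c"] by (metis store3_simps)+

lemma exec_Pop3:
  "exec (Pop R0) (store3 (x # a) b c) 1 (store3 a b c)"
  "exec (Pop R1) (store3 a (x # b) c) 1 (store3 a b c)"
  "exec (Pop R2) (store3 a b (x # c)) 1 (store3 a b c)"
  using exec_Pop[of R0 "store3 (x # a) b c"] exec_Pop[of R1 "store3 a (x # b) c"] exec_Pop[of R2 "store3 a b (x # c)"]
  by simp_all

text \<open>The number of trees still to be moved is kept in unary on \<open>R2\<close>, above a \<open>Hash\<close>.\<close>

definition save_loop :: com where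
  "save_loop = While_Top R2 (\<lambda>v. v = Some One) (If_Top R0 (\<lambda>v. v = Some One)
     (Seq (Pop R0) (Seq (Push R1 One) (Push R2 One))) (Seq (Pop R0) (Seq (Push R1 Zero) (Pop R2))))"

text \<open>Stated for a list \<open>ts\<close> of pending trees, since scanning a
  \<open>Node\<close> replaces one of them by its two subtrees and scanning a \<open>Leaf\<close>
  removes one. Each symbol costs 7 steps: loop test, branch test and five for the body.\<close>

lemma exec_save_loop:
  "exec save_loop (store3 (concat (map code ts) @ a) b (replicate (length ts) One @ Hash # c))
    (7 * length (concat (map code ts)) + 1)
    (store3 a (rev (concat (map code ts)) @ b) (Hash # c))"
proof (induction "length (concat (map code ts))" arbitrary: ts b rule: less_induct)
  case less
  show ?case
  proof (cases ts)
    case Nil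
    then show ?thesis by (auto simp: save_loop_def intro!: exec_mono[OF exec_While_stop])
  next
    case (Cons t us)
    show ?thesis
    proof (cases t)
      case Leaf
      have IH: "exec save_loop (store3 (concat (map code us) @ a) (Zero # b) (replicate (length us) One @ Hash # c))
        (7 * length (concat (map code us)) + 1) (store3 a (rev (concat (map code us)) @ Zero # b) (Hash # c))"
        by (rule less) (simp add: Cons Leaf)
      have body: "exec (Seq (Pop R0) (Seq (Push R1 Zero) (Pop R2)))
        (store3 (Zero # concat (map code us) @ a) b (One # replicate (length us) One @ Hash # c)) (Suc (1 + Suc (1 + 1)))
        (store3 (concat (map code us) @ a) (Zero # b) (replicate (length us) One @ Hash # c))"
        by (rule exec_Seq exec_Push3 exec_Pop3)+
      have "exec save_loop (store3 (Zero # concat (map code us) @ a) b (One # replicate (length us) One @ Hash # c))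
        (Suc (Suc (Suc (1 + Suc (1 + 1))) + (7 * length (concat (map code us)) + 1)))
        (store3 a (rev (concat (map code us)) @ Zero # b) (Hash # c))"
        unfolding save_loop_def
        by (rule exec_While_step[OF _ exec_If IH[unfolded save_loop_def]])
           (use body in simp_all)
      then show ?thesis by (auto simp: Cons Leaf elim!: exec_mono)
    next
      case (Node l r)
      have IH: "exec save_loop (store3 (concat (map code (l # r # us)) @ a) (One # b) (replicate (length (l # r # us)) One @ Hash # c))
        (7 * length (concat (map code (l # r # us))) + 1) (store3 a (rev (concat (map code (l # r # us))) @ One # b) (Hash # c))"
        by (rule less) (simp add: Cons Node)
      have body: "exec (Seq (Pop R0) (Seq (Push R1 One) (Push R2 One)))
        (store3 (One # concat (map code (l # r # us)) @ a) b (One # replicate (length us) One @ Hash # c)) (Suc (1 + Suc (1 + 1)))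
        (store3 (concat (map code (l # r # us)) @ a) (One # b) (One # One # replicate (length us) One @ Hash # c))"
        by (rule exec_Seq exec_Push3 exec_Pop3)+
      have "exec save_loop (store3 (One # concat (map code (l # r # us)) @ a) b (One # replicate (length us) One @ Hash # c))
        (Suc (Suc (Suc (1 + Suc (1 + 1))) + (7 * length (concat (map code (l # r # us))) + 1)))
        (store3 a (rev (concat (map code (l # r # us))) @ One # b) (Hash # c))"
        unfolding save_loop_def
        by (rule exec_While_step[OF _ exec_If IH[unfolded save_loop_def]])
           (use body in simp_all)
      then show ?thesis by (auto simp: Cons Node elim!: exec_mono)
    qed
  qed
qed

text \<open>The \<open>Hash\<close> pushed on \<open>R1\<close> occurs in no code, so it later tells
  \<open>pour\<close> where the saved tree ends, without any counting.\<close>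

definition save :: com where
  "save = Seq (Push R1 Hash) (Seq (Push R2 Hash) (Seq (Push R2 One) (Seq save_loop (Pop R2))))"

lemma exec_save:
  "exec save (store3 (code t @ a) b c) (7 * length (code t) + 9) (store3 a (rev (code t) @ Hash # b) c)"
proof -
  have "exec save (store3 (code t @ a) b c) (Suc (1 + Suc (1 + Suc (1 + Suc ((7 * length (code t) + 1) + 1)))))
    (store3 a (rev (code t) @ Hash # b) c)"
    unfolding save_def
    using exec_save_loop[of "[t]" a "Hash # b" c]
    by (intro exec_Seq[OF exec_Push3(2)] exec_Seq[OF exec_Push3(3)] exec_Seq[OF _ exec_Pop3(3)]) simp
  then show ?thesis by (rule exec_mono) simp
qed

definition transfer :: "reg \<Rightarrow> (sym \<Rightarrow> com) \<Rightarrow> com" where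
  "transfer r f = While_Top r (\<lambda>v. v = Some One \<or> v = Some Zero)
     (If_Top r (\<lambda>v. v = Some One) (Seq (Pop r) (f One)) (Seq (Pop r) (f Zero)))"

text \<open>\<open>G w d\<close> is the store with \<open>w\<close> still on the source and
  \<open>d\<close> already processed; leaving it abstract lets one loop restore, discard, duplicate
  or re-encode a word. Below the word lies \<open>q\<close>, in practice a \<open>Hash\<close> or
  nothing.\<close>

lemma exec_transfer:
  assumes G: "\<And>w d. G w d r = w @ q"
    and f: "\<And>a w d. a = One \<or> a = Zero \<Longrightarrow> exec (f a) ((G (a # w) d)(r := w @ q)) k (G w (a # d))"
    and q: "top_of q \<noteq> Some One" "top_of q \<noteq> Some Zero" and w: "Hash \<notin> set w"
  shows "exec (transfer r f) (G w d) ((k + 4) * length w + 1) (G [] (rev w @ d))"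
  using w
proof (induction w arbitrary: d)
  case Nil
  show ?case unfolding transfer_def by (auto intro!: exec_mono[OF exec_While_stop] simp: G q)
next
  case (Cons a w)
  then have a: "a = One \<or> a = Zero" by (cases a) auto
  have pop: "exec (Pop r) (G (a # w) d) 1 ((G (a # w) d)(r := w @ q))"
    using exec_Pop[of r "G (a # w) d"] by (simp add: G)
  have IH: "exec (transfer r f) (G w (a # d)) ((k + 4) * length w + 1) (G [] (rev w @ a # d))"
    using Cons by auto
  have "exec (transfer r f) (G (a # w) d) (Suc (Suc (Suc (1 + k)) + ((k + 4) * length w + 1))) (G [] (rev w @ a # d))"
    unfolding transfer_def
    by (rule exec_While_step[OF _ exec_If IH[unfolded transfer_def]]) (use a exec_Seq[OF pop f[OF a]] in \<open>auto simp: G\<close>)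
  then show ?case by (auto elim!: exec_mono)
qed

definition pour :: "reg \<Rightarrow> (sym \<Rightarrow> com) \<Rightarrow> com" where
  "pour r f = Seq (transfer r f) (Pop r)"

lemma exec_pour:
  assumes G: "\<And>w d. G w d r = w @ Hash # q"
    and f: "\<And>a w d. a = One \<or> a = Zero \<Longrightarrow> exec (f a) ((G (a # w) d)(r := w @ Hash # q)) k (G w (a # d))"
    and w: "Hash \<notin> set w"
  shows "exec (pour r f) (G w d) ((k + 4) * length w + 3) ((G [] (rev w @ d))(r := q))"
proof -
  have "exec (transfer r f) (G w d) ((k + 4) * length w + 1) (G [] (rev w @ d))"
    using w by (intro exec_transfer[OF G f]) auto
  then have "exec (pour r f) (G w d) (Suc (((k + 4) * length w + 1) + 1)) ((G [] (rev w @ d))(r := tl (G [] (rev w @ d) r)))"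
    unfolding pour_def by (rule exec_Seq[OF _ exec_Pop])
  then have "exec (pour r f) (G w d) (Suc (((k + 4) * length w + 1) + 1)) ((G [] (rev w @ d))(r := q))"
    by (simp add: G)
  then show ?thesis by (rule exec_mono) simp
qed

definition restore :: com where "restore = pour R1 (Push R0)"

lemma exec_restore:
  assumes "Hash \<notin> set w"
  shows "exec restore (store3 a (w @ Hash # b) c) (5 * length w + 3) (store3 (rev w @ a) b c)"
  using exec_pour[of "\<lambda>w d. store3 (d @ a) (w @ Hash # b) c" R1 b "Push R0" 1 w "[]"] assms
  by (simp add: restore_def exec_Push3)

definition drop_top :: com where "drop_top = Seq save (pour R1 (\<lambda>_. Skip))"

lemma exec_drop_top: "exec drop_top (store3 (code t @ a) b c) (12 * length (code t) + 13) (store3 a b c)"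
proof -
  have "exec (pour R1 (\<lambda>_. Skip)) (store3 a (rev (code t) @ Hash # b) c) (5 * length (code t) + 3) (store3 a b c)"
    using exec_pour[of "\<lambda>w d. store3 a (w @ Hash # b) c" R1 b "\<lambda>_. Skip" 1 "rev (code t)" "[]"] by (simp add: exec_Skip)
  from exec_Seq[OF exec_save this] show ?thesis unfolding drop_top_def by (rule exec_mono) simp
qed

text \<open>Every move between stacks reverses a word. The copy collected on \<open>R2\<close> has
  the right order already, so it takes the detour over \<open>R1\<close> to arrive on
  \<open>R0\<close> unreversed.\<close>

definition dup :: com where
  "dup = Seq save (Seq (Push R2 Hash) (Seq (pour R1 (\<lambda>x. Seq (Push R0 x) (Push R2 x)))
     (Seq (Push R1 Hash) (Seq (pour R2 (Push R1)) restore))))"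

lemma exec_dup: "exec dup (store3 (code t @ a) b c) (24 * length (code t) + 25) (store3 (code t @ code t @ a) b c)"
proof -
  let ?w = "code t"
  have 1: "exec (pour R1 (\<lambda>x. Seq (Push R0 x) (Push R2 x))) (store3 a (rev ?w @ Hash # b) (Hash # c))
    (7 * length ?w + 3) (store3 (?w @ a) b (?w @ Hash # c))"
    using exec_pour[of "\<lambda>w d. store3 (d @ a) (w @ Hash # b) (d @ Hash # c)" R1 b "\<lambda>x. Seq (Push R0 x) (Push R2 x)" 3 "rev ?w" "[]"]
      exec_Seq[OF exec_Push3(1) exec_Push3(3)] by (simp add: numeral_eq_Suc)
  have 2: "exec (pour R2 (Push R1)) (store3 (?w @ a) (Hash # b) (?w @ Hash # c))
    (5 * length ?w + 3) (store3 (?w @ a) (rev ?w @ Hash # b) c)"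
    using exec_pour[of "\<lambda>w d. store3 (?w @ a) (d @ Hash # b) (w @ Hash # c)" R2 c "Push R1" 1 "?w" "[]"]
    by (simp add: exec_Push3)
  have 3: "exec restore (store3 (?w @ a) (rev ?w @ Hash # b) c) (5 * length ?w + 3) (store3 (?w @ ?w @ a) b c)"
    using exec_restore[of "rev ?w"] by simp
  show ?thesis unfolding dup_def
    by (rule exec_mono[OF exec_Seq[OF exec_save exec_Seq[OF exec_Push3(3) exec_Seq[OF 1 exec_Seq[OF exec_Push3(2) exec_Seq[OF 2 3]]]]]]) simp
qed

fun push_all :: "sym list \<Rightarrow> com" where
  "push_all [] = Skip"
| "push_all (a # w) = Seq (push_all w) (Push R0 a)"

lemma exec_push_all: "exec (push_all w) (store3 a b c) (2 * length w + 1) (store3 (w @ a) b c)"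
proof (induction w)
  case Nil
  show ?case by (simp add: exec_Skip)
next
  case (Cons x w)
  show ?case using exec_mono[OF exec_Seq[OF Cons exec_Push3(1)]] by simp
qed

section \<open>Functions computable in polynomially bounded time\<close>

class enc =
  fixes encd :: "'a \<Rightarrow> tree"

instantiation bool :: enc begin
definition "encd_bool b = (if b then Node Leaf Leaf else Leaf)"
instance ..
end

instantiation prod :: (enc, enc) enc begin
definition "encd_prod p = Node (encd (fst p)) (encd (snd p))"
instance ..
end

instantiation list :: (enc) enc begin
primrec encd_list :: "'a list \<Rightarrow> tree" where
  "encd_list [] = Leaf"
| "encd_list (x # xs) = Node (encd x) (encd_list xs)"
instance ..
end

declare bin_digits.simps [simp del]

text \<open>With the least significant digit first, \<open>odd\<close> and \<open>div 2\<close>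
  become head and tail, and recursion on halves becomes recursion on lists.\<close>

instantiation nat :: enc begin
definition "encd_nat (n :: nat) = encd (bin_digits n)"
instance ..
end

lemma encd_list_simps [simp]:
  "encd ([] :: 'a::enc list) = Leaf" "encd (x # xs :: 'a::enc list) = Node (encd x) (encd xs)"
  "encd (a, b) = Node (encd a) (encd b)"
  "encd True = Node Leaf Leaf" "encd False = Leaf"
  by (simp_all add: encd_prod_def encd_bool_def)

definition sz :: "'a::enc \<Rightarrow> nat" where
  "sz x = length (code (encd x))"

lemma sz_simps [simp]:
  "sz ([] :: 'a::enc list) = 1" "sz (y # ys :: 'a list) = Suc (sz y + sz ys)"
  "sz (a :: 'a, b :: 'b::enc) = Suc (sz a + sz b)"
  by (simp_all add: sz_def)

lemma sz_pair: "sz (p :: 'a::enc \<times> 'b::enc) = Suc (sz (fst p) + sz (snd p))"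
  by (cases p) simp

lemma sz_bool: "sz (b :: bool) \<le> 3"
  by (cases b) (simp_all add: sz_def)

lemma sz_pos [simp]: "0 < sz x"
  by (cases "encd x") (simp_all add: sz_def)

lemma sz_append: "Suc (sz (xs @ ys :: 'a::enc list)) = sz xs + sz ys"
  by (induction xs) auto

text \<open>The contents \<open>a\<close>, \<open>b\<close>, \<open>c\<close> below the argument are arbitrary and preserved, which lets programs be
  used as subroutines while intermediate results wait on the stacks.\<close>

definition PT :: "('a::enc \<Rightarrow> nat) \<Rightarrow> ('a \<Rightarrow> 'b::enc) \<Rightarrow> bool" where
  "PT M f = (poly_bounded M sz \<and> (\<exists>p T. poly_bounded M T \<and>
     (\<forall>x a b c. exec p (store3 (code (encd x) @ a) b c) (T x) (store3 (code (encd (f x)) @ a) b c))))"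

lemma PT_I:
  assumes "poly_bounded M sz" "poly_bounded M T"
    and "\<And>x a b c. exec p (store3 (code (encd x) @ a) b c) (T x) (store3 (code (encd (f x)) @ a) b c)"
  shows "PT M f"
  using assms unfolding PT_def by blast

lemma PT_E:
  assumes "PT M f"
  obtains p T where "poly_bounded M T"
    and "\<And>x a b c. exec p (store3 (code (encd x) @ a) b c) (T x) (store3 (code (encd (f x)) @ a) b c)"
  using assms unfolding PT_def by blast

text \<open>\<open>PT\<close> contains this bound because generic programs, such as those that copy
  or drop the argument, take time linear in its code length.\<close>

lemma PT_dom: "PT M f \<Longrightarrow> poly_bounded M sz"
  by (simp add: PT_def)

text \<open>A step pushes at most one symbol, so the output exceeds the input by at most the running
  time.\<close>

lemma PT_size:
  assumes "PT M f"
  shows "poly_bounded M (\<lambda>x. sz (f x))"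
proof -
  obtain p T where pT: "poly_bounded M T"
    "\<And>x a b c. exec p (store3 (code (encd x) @ a) b c) (T x) (store3 (code (encd (f x)) @ a) b c)"
    using assms by (rule PT_E) (rule that)
  have "sz (f x) \<le> sz x + T x" for x
  proof -
    obtain t where t: "t \<le> T x" "runs p (store3 (code (encd x) @ []) [] []) t (store3 (code (encd (f x)) @ []) [] [])"
      using pT(2)[of x "[]" "[]" "[]"] unfolding exec_def by blast
    show ?thesis using runs_length[OF t(2), of R0] t(1) by (simp add: sz_def)
  qed
  then show ?thesis using pb_add[OF PT_dom[OF assms] pT(1)] by (blast intro: pb_le)
qed

text \<open>Programs see only codes, so the result types of \<open>f\<close> and \<open>g\<close>
  may differ; operations on digit lists thereby become operations on numbers.\<close>

lemma PT_recode: "PT M g \<Longrightarrow> (\<And>x. encd (f x) = encd (g x)) \<Longrightarrow> PT M f"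
  unfolding PT_def by simp

named_theorems PT_intros

lemma PT_id: "poly_bounded M sz \<Longrightarrow> PT M (\<lambda>x. x)"
  by (rule PT_I[where T = "\<lambda>_. 1" and p = Skip]) (auto intro: pb_const exec_Skip)

lemma PT_id_sz [PT_intros]: "PT sz (\<lambda>x. x)"
  by (rule PT_id) (rule pb_self)

lemma PT_comp:
  assumes "PT sz g" "PT M f"
  shows "PT M (\<lambda>x. g (f x))"
proof -
  obtain p T where p: "poly_bounded M T"
    "\<And>x a b c. exec p (store3 (code (encd x) @ a) b c) (T x) (store3 (code (encd (f x)) @ a) b c)"
    using assms(2) by (rule PT_E) (rule that)
  obtain q U where q: "poly_bounded sz U"
    "\<And>x a b c. exec q (store3 (code (encd x) @ a) b c) (U x) (store3 (code (encd (g x)) @ a) b c)"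
    using assms(1) by (rule PT_E) (rule that)
  show ?thesis
    by (rule PT_I[OF PT_dom[OF assms(2)] _ exec_Seq[OF p(2) q(2)]])
      (intro pb_intros p(1) pb_comp[OF q(1)] PT_size[OF assms(2)])
qed

lemma PT_const:
  assumes "poly_bounded M sz"
  shows "PT M (\<lambda>_. k)"
proof (rule PT_I[OF assms])
  show "exec (Seq drop_top (push_all (code (encd k)))) (store3 (code (encd x) @ a) b c)
    (Suc ((12 * sz x + 13) + (2 * sz k + 1))) (store3 (code (encd k) @ a) b c)" for x a b c
    unfolding sz_def by (rule exec_Seq[OF exec_drop_top exec_push_all])
  show "poly_bounded M (\<lambda>x. Suc ((12 * sz x + 13) + (2 * sz k + 1)))"
    by (intro pb_intros assms)
qed

lemma PT_const_sz [PT_intros]: "PT sz (\<lambda>_. k)"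
  by (rule PT_const) (rule pb_self)

lemma exec_restore_code:
  "exec restore (store3 a (rev (code t) @ Hash # b) c) (5 * length (code t) + 3) (store3 (code t @ a) b c)"
  using exec_restore[of "rev (code t)" a b c] by simp

text \<open>Pairs and non-empty lists are both coded by \<open>Node\<close>, hence the general
  \<open>h\<close>. The first result waits on \<open>R1\<close> while the second is computed from a
  copy of the argument.\<close>

lemma PT_Pair:
  fixes f :: "'a::enc \<Rightarrow> 'b::enc" and g :: "'a \<Rightarrow> 'c::enc"
  assumes "PT M f" "PT M g" and h: "\<And>x. encd (h x) = Node (encd (f x)) (encd (g x))"
  shows "PT M h"
proof -
  obtain p T where p: "poly_bounded M T"
    "\<And>x a b c. exec p (store3 (code (encd x) @ a) b c) (T x) (store3 (code (encd (f x)) @ a) b c)"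
    using assms(1) by (rule PT_E) (rule that)
  obtain q U where q: "poly_bounded M U"
    "\<And>x a b c. exec q (store3 (code (encd x) @ a) b c) (U x) (store3 (code (encd (g x)) @ a) b c)"
    using assms(2) by (rule PT_E) (rule that)
  show ?thesis
  proof (rule PT_I[OF PT_dom[OF assms(1)]])
    show "exec (Seq dup (Seq p (Seq save (Seq q (Seq restore (Push R0 One))))))
      (store3 (code (encd x) @ a) b c)
      (Suc ((24 * sz x + 25) + Suc (T x + Suc ((7 * sz (f x) + 9) + Suc (U x + Suc ((5 * sz (f x) + 3) + 1))))))
      (store3 (code (encd (h x)) @ a) b c)" for x a b c
      unfolding sz_def h code.simps append_Cons append_assoc
      by (rule exec_Seq[OF exec_dup exec_Seq[OF p(2) exec_Seq[OF exec_save exec_Seq[OF q(2) exec_Seq[OF exec_restore_code exec_Push3(1)]]]]])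
    show "poly_bounded M (\<lambda>x. Suc ((24 * sz x + 25) + Suc (T x + Suc ((7 * sz (f x) + 9) + Suc (U x + Suc ((5 * sz (f x) + 3) + 1))))))"
      by (intro pb_intros p(1) q(1) PT_size[OF assms(1)] PT_dom[OF assms(1)])
  qed
qed

lemma PT_prod [PT_intros]: "PT M f \<Longrightarrow> PT M g \<Longrightarrow> PT M (\<lambda>x. (f x, g x))"
  by (erule PT_Pair) simp_all

lemma PT_Cons [PT_intros]: "PT M f \<Longrightarrow> PT M g \<Longrightarrow> PT M (\<lambda>x. f x # g x)"
  by (erule PT_Pair) simp_all

lemma PT_fst_sz: "PT sz fst"
proof (rule PT_I[OF pb_self])
  show "exec (Seq (Pop R0) (Seq save (Seq drop_top restore))) (store3 (code (encd x) @ a) b c)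
     (Suc (1 + Suc ((7 * sz (fst x) + 9) + Suc ((12 * sz (snd x) + 13) + (5 * sz (fst x) + 3)))))
     (store3 (code (encd (fst x)) @ a) b c)" for x a b c
    unfolding encd_prod_def sz_def code.simps append_Cons append_assoc
    by (rule exec_Seq[OF exec_Pop3(1) exec_Seq[OF exec_save exec_Seq[OF exec_drop_top exec_restore_code]]])
  show "poly_bounded sz (\<lambda>x. Suc (1 + Suc ((7 * sz (fst x) + 9) + Suc ((12 * sz (snd x) + 13) + (5 * sz (fst x) + 3)))))"
    by (rule pb_le[of _ "\<lambda>x. 24 * sz x + 40"], intro pb_intros) (auto simp: sz_pair)
qed

lemma PT_snd_sz: "PT sz snd"
proof (rule PT_I[OF pb_self])
  show "exec (Seq (Pop R0) drop_top) (store3 (code (encd x) @ a) b c)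
     (Suc (1 + (12 * sz (fst x) + 13)))
     (store3 (code (encd (snd x)) @ a) b c)" for x a b c
    unfolding encd_prod_def sz_def code.simps append_Cons append_assoc
    by (rule exec_Seq[OF exec_Pop3(1) exec_drop_top])
  show "poly_bounded sz (\<lambda>x. Suc (1 + (12 * sz (fst x) + 13)))"
    by (rule pb_le[of _ "\<lambda>x. 12 * sz x + 40"], intro pb_intros) (auto simp: sz_pair)
qed

lemmas PT_fst [PT_intros] = PT_comp[OF PT_fst_sz]
lemmas PT_snd [PT_intros] = PT_comp[OF PT_snd_sz]

lemma top_code: "top_of (code t @ a) = Some One \<longleftrightarrow> t \<noteq> Leaf"
  by (cases t) auto

lemma PT_If [PT_intros]:
  assumes "PT M P" "PT M f" "PT M g"
  shows "PT M (\<lambda>x. if P x then f x else g x)"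
proof -
  obtain p T where p: "poly_bounded M T"
    "\<And>x a b c. exec p (store3 (code (encd x) @ a) b c) (T x) (store3 (code (encd (P x)) @ a) b c)"
    using assms(1) by (rule PT_E) (rule that)
  obtain q U where q: "poly_bounded M U"
    "\<And>x a b c. exec q (store3 (code (encd x) @ a) b c) (U x) (store3 (code (encd (f x)) @ a) b c)"
    using assms(2) by (rule PT_E) (rule that)
  obtain r V where r: "poly_bounded M V"
    "\<And>x a b c. exec r (store3 (code (encd x) @ a) b c) (V x) (store3 (code (encd (g x)) @ a) b c)"
    using assms(3) by (rule PT_E) (rule that)
  let ?B = "\<lambda>x. Suc (Suc ((12 * sz (P x) + 13) + (U x + V x)))"
  have branch: "exec (If_Top R0 (\<lambda>v. v = Some One) (Seq drop_top q) (Seq drop_top r))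
     (store3 (code (encd (P x)) @ code (encd x) @ a) b c) (?B x)
     (store3 (code (encd (if P x then f x else g x)) @ a) b c)" for x a b c
  proof (rule exec_If)
    have "exec (Seq drop_top q) (store3 (code (encd (P x)) @ code (encd x) @ a) b c)
      (Suc ((12 * sz (P x) + 13) + U x)) (store3 (code (encd (f x)) @ a) b c)"
      unfolding sz_def by (rule exec_Seq[OF exec_drop_top q(2)])
    moreover have "exec (Seq drop_top r) (store3 (code (encd (P x)) @ code (encd x) @ a) b c)
      (Suc ((12 * sz (P x) + 13) + V x)) (store3 (code (encd (g x)) @ a) b c)"
      unfolding sz_def by (rule exec_Seq[OF exec_drop_top r(2)])
    ultimately show "exec (if top_of (store3 (code (encd (P x)) @ code (encd x) @ a) b c R0) = Some One then Seq drop_top q else Seq drop_top r)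
      (store3 (code (encd (P x)) @ code (encd x) @ a) b c) (Suc ((12 * sz (P x) + 13) + (U x + V x)))
      (store3 (code (encd (if P x then f x else g x)) @ a) b c)"
      by (auto simp: top_code encd_bool_def elim!: exec_mono)
  qed
  show ?thesis
  proof (rule PT_I[OF PT_dom[OF assms(1)]])
    show "exec (Seq dup (Seq p (If_Top R0 (\<lambda>v. v = Some One) (Seq drop_top q) (Seq drop_top r))))
      (store3 (code (encd x) @ a) b c) (Suc ((24 * sz x + 25) + Suc (T x + ?B x)))
      (store3 (code (encd (if P x then f x else g x)) @ a) b c)" for x a b c
      unfolding sz_def[of x] by (rule exec_Seq[OF exec_dup exec_Seq[OF p(2) branch]])
    show "poly_bounded M (\<lambda>x. Suc ((24 * sz x + 25) + Suc (T x + ?B x)))"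
      by (intro pb_intros p(1) q(1) r(1) PT_size[OF assms(1)] PT_dom[OF assms(1)])
  qed
qed

text \<open>Pushing a single \<open>One\<close> turns the code of \<open>y # ys\<close> followed by that of \<open>x\<close> into the code of \<open>((y, ys), x)\<close>.\<close>

lemma PT_case_list [PT_intros]:
  assumes "PT M l" "PT M g" "PT sz (\<lambda>p. h (fst (fst p)) (snd (fst p)) (snd p))"
  shows "PT M (\<lambda>x. case l x of [] \<Rightarrow> g x | y # ys \<Rightarrow> h y ys x)"
proof -
  let ?h = "\<lambda>p. h (fst (fst p)) (snd (fst p)) (snd p)"
  obtain p T where p: "poly_bounded M T"
    "\<And>x a b c. exec p (store3 (code (encd x) @ a) b c) (T x) (store3 (code (encd (l x)) @ a) b c)"
    using assms(1) by (rule PT_E) (rule that)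
  obtain q U where q: "poly_bounded M U"
    "\<And>x a b c. exec q (store3 (code (encd x) @ a) b c) (U x) (store3 (code (encd (g x)) @ a) b c)"
    using assms(2) by (rule PT_E) (rule that)
  obtain r V where r: "poly_bounded sz V"
    "\<And>x a b c. exec r (store3 (code (encd x) @ a) b c) (V x) (store3 (code (encd (?h x)) @ a) b c)"
    using assms(3) by (rule PT_E) (rule that)
  obtain k where k: "\<And>x. V x \<le> (sz x + 2) ^ k" using r(1) unfolding poly_bounded_def by blast
  \<comment> \<open>\<open>V\<close> refers to \<open>((y, ys), x)\<close>, which exists only for a
    non-empty list; its code has length \<open>Suc (sz (l x) + sz x)\<close>, so \<open>?Z\<close>
    bounds the time in terms of \<open>x\<close> alone.\<close>
  let ?Z = "\<lambda>x. (Suc (sz (l x) + sz x) + 2) ^ k"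
  let ?res = "\<lambda>x. case l x of [] \<Rightarrow> g x | y # ys \<Rightarrow> h y ys x"
  have branch: "exec (If_Top R0 (\<lambda>v. v = Some One) (Seq (Push R0 One) r) (Seq (Pop R0) q))
     (store3 (code (encd (l x)) @ code (encd x) @ a) b c) (Suc (Suc (1 + (U x + ?Z x))))
     (store3 (code (encd (?res x)) @ a) b c)" for x a b c
  proof (rule exec_If)
    show "exec (if top_of (store3 (code (encd (l x)) @ code (encd x) @ a) b c R0) = Some One then Seq (Push R0 One) r else Seq (Pop R0) q)
      (store3 (code (encd (l x)) @ code (encd x) @ a) b c) (Suc (1 + (U x + ?Z x)))
      (store3 (code (encd (?res x)) @ a) b c)"
    proof (cases "l x")
      case Nil
      have "exec (Seq (Pop R0) q) (store3 (Zero # code (encd x) @ a) b c) (Suc (1 + U x)) (store3 (code (encd (g x)) @ a) b c)"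
        by (rule exec_Seq[OF exec_Pop3(1) q(2)])
      then show ?thesis by (auto simp: Nil elim!: exec_mono)
    next
      case (Cons y ys)
      have "code (encd ((y, ys), x)) @ a = One # One # code (encd y) @ code (encd ys) @ code (encd x) @ a"
        by simp
      then have "exec r (store3 (One # One # code (encd y) @ code (encd ys) @ code (encd x) @ a) b c) (V ((y, ys), x))
        (store3 (code (encd (h y ys x)) @ a) b c)"
        using r(2)[of "((y, ys), x)" a b c] by simp
      from exec_Seq[OF exec_Push3(1) this] have "exec (Seq (Push R0 One) r) (store3 (code (encd (l x)) @ code (encd x) @ a) b c)
        (Suc (1 + V ((y, ys), x))) (store3 (code (encd (?res x)) @ a) b c)"
        by (simp add: Cons)
      then have "exec (Seq (Push R0 One) r) (store3 (code (encd (l x)) @ code (encd x) @ a) b c)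
        (Suc (1 + (U x + ?Z x))) (store3 (code (encd (?res x)) @ a) b c)"
        using k[of "((y, ys), x)"] by (elim exec_mono) (simp add: Cons)
      then show ?thesis by (simp add: top_code Cons)
    qed
  qed
  show ?thesis
  proof (rule PT_I[OF PT_dom[OF assms(1)]])
    show "exec (Seq dup (Seq p (If_Top R0 (\<lambda>v. v = Some One) (Seq (Push R0 One) r) (Seq (Pop R0) q))))
      (store3 (code (encd x) @ a) b c) (Suc ((24 * sz x + 25) + Suc (T x + Suc (Suc (1 + (U x + ?Z x))))))
      (store3 (code (encd (?res x)) @ a) b c)" for x a b c
      by (rule exec_mono[OF exec_Seq[OF exec_dup exec_Seq[OF p(2) branch]]]) (simp add: sz_def)
    show "poly_bounded M (\<lambda>x. Suc ((24 * sz x + 25) + Suc (T x + Suc (Suc (1 + (U x + ?Z x))))))"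
      by (intro pb_intros p(1) q(1) PT_size[OF assms(1)] PT_dom[OF assms(1)])
  qed
qed

text \<open>A polynomial \<open>f\<close> could square the size in every round, so the intermediate
  sizes need a bound \<open>Z\<close> besides the bound on the number of rounds. The program never
  computes \<open>n x\<close>; it stops when \<open>P\<close> fails.\<close>

lemma PT_while:
  fixes P :: "'s::enc \<Rightarrow> bool" and f :: "'s \<Rightarrow> 's" and g :: "'a::enc \<Rightarrow> 's"
  assumes P: "PT sz P" and f: "PT sz f" and g: "PT M g"
    and n: "poly_bounded M n" and Z: "poly_bounded M Z"
    and size: "\<And>x i. i \<le> n x \<Longrightarrow> sz ((f ^^ i) (g x)) \<le> Z x"
    and cont: "\<And>x i. i < n x \<Longrightarrow> P ((f ^^ i) (g x))"
    and stop: "\<And>x. \<not> P ((f ^^ n x) (g x))"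
  shows "PT M (\<lambda>x. (f ^^ n x) (g x))"
proof -
  obtain p T where p: "poly_bounded sz T"
    "\<And>x a b c. exec p (store3 (code (encd x) @ a) b c) (T x) (store3 (code (encd (P x)) @ a) b c)"
    using P by (rule PT_E) (rule that)
  obtain q U where q: "poly_bounded sz U"
    "\<And>x a b c. exec q (store3 (code (encd x) @ a) b c) (U x) (store3 (code (encd (f x)) @ a) b c)"
    using f by (rule PT_E) (rule that)
  obtain r V where r: "poly_bounded M V"
    "\<And>x a b c. exec r (store3 (code (encd x) @ a) b c) (V x) (store3 (code (encd (g x)) @ a) b c)"
    using g by (rule PT_E) (rule that)
  obtain j where j: "\<And>x. T x \<le> (sz x + 2) ^ j" using p(1) unfolding poly_bounded_def by blast
  obtain k where k: "\<And>x. U x \<le> (sz x + 2) ^ k" using q(1) unfolding poly_bounded_def by blast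
  define test where "test = Seq dup p"
  \<comment> \<open>Each round starts by discarding the Boolean left by the previous test and ends
    with a fresh one.\<close>
  define body where "body = Seq drop_top (Seq q test)"
  define W where "W = While_Top R0 (\<lambda>v. v = Some One) body"
  let ?tt = "\<lambda>z. 24 * z + 26 + (z + 2) ^ j"
  \<comment> \<open>51 = 12 * 3 + 13 + 2: dropping the three symbols of the code of
    \<open>True\<close>, and two sequencing steps.\<close>
  let ?B = "\<lambda>z. 51 + ((z + 2) ^ k + ?tt z)"
  have test: "exec test (store3 (code (encd y) @ a) b c) (?tt z) (store3 (code (encd (P y)) @ code (encd y) @ a) b c)"
    if "sz y \<le> z" for y a b c z
  proof -
    have "T y \<le> (z + 2) ^ j" using j[of y] that power_mono[of "sz y + 2" "z + 2" j] by simp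
    then show ?thesis unfolding test_def using that
      by (intro exec_mono[OF exec_Seq[OF exec_dup p(2)]]) (simp add: sz_def)
  qed
  have loop: "exec W (store3 (code (encd (P y)) @ code (encd y) @ a) b c) (m * (?B z + 1) + 1)
     (store3 (code (encd False) @ code (encd ((f ^^ m) y)) @ a) b c)"
    if "\<And>i. i \<le> m \<Longrightarrow> sz ((f ^^ i) y) \<le> z" "\<And>i. i < m \<Longrightarrow> P ((f ^^ i) y)" "\<not> P ((f ^^ m) y)" for m y a b c z
    using that
  proof (induction m arbitrary: y)
    case 0
    then show ?case unfolding W_def by (auto intro!: exec_mono[OF exec_While_stop])
  next
    case (Suc m)
    have y: "P y" using Suc.prems(2)[of 0] by simp
    have zf: "sz y \<le> z" "sz (f y) \<le> z" using Suc.prems(1)[of 0] Suc.prems(1)[of "Suc 0"] by auto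
    have "U y \<le> (z + 2) ^ k" using k[of y] zf(1) power_mono[of "sz y + 2" "z + 2" k] by simp
    then have body: "exec body (store3 (code (encd (P y)) @ code (encd y) @ a) b c) (?B z)
      (store3 (code (encd (P (f y))) @ code (encd (f y)) @ a) b c)"
      unfolding body_def
      by (intro exec_mono[OF exec_Seq[OF exec_drop_top exec_Seq[OF q(2) test[OF zf(2)]]]]) (simp add: y)
    have IH: "exec W (store3 (code (encd (P (f y))) @ code (encd (f y)) @ a) b c) (m * (?B z + 1) + 1)
     (store3 (code (encd False) @ code (encd ((f ^^ m) (f y))) @ a) b c)"
      by (rule Suc.IH) (use Suc.prems(1)[of "Suc _"] Suc.prems(2)[of "Suc _"] Suc.prems(3) in \<open>simp_all add: funpow_swap1\<close>)
    have "exec W (store3 (code (encd (P y)) @ code (encd y) @ a) b c) (Suc (?B z + (m * (?B z + 1) + 1)))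
     (store3 (code (encd False) @ code (encd ((f ^^ m) (f y))) @ a) b c)"
      unfolding W_def by (rule exec_While_step[OF _ body IH[unfolded W_def]]) (simp add: y)
    then show ?case by (simp add: funpow_swap1 algebra_simps)
  qed
  show ?thesis
  proof (rule PT_I[OF PT_dom[OF g]])
    show "exec (Seq r (Seq test (Seq W (Pop R0)))) (store3 (code (encd x) @ a) b c)
      (Suc (V x + Suc (?tt (Z x) + Suc ((n x * (?B (Z x) + 1) + 1) + 1))))
      (store3 (code (encd ((f ^^ n x) (g x))) @ a) b c)" for x a b c
    proof (rule exec_Seq[OF r(2) exec_Seq[OF test exec_Seq[OF loop]]])
      show "sz (g x) \<le> Z x" using size[of 0 x] by simp
      show "exec (Pop R0) (store3 (code (encd False) @ code (encd ((f ^^ n x) (g x))) @ a) b c) 1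
         (store3 (code (encd ((f ^^ n x) (g x))) @ a) b c)" using exec_Pop3(1) by simp
    qed (use size cont stop in auto)
    show "poly_bounded M (\<lambda>x. Suc (V x + Suc (?tt (Z x) + Suc ((n x * (?B (Z x) + 1) + 1) + 1))))"
      by (intro pb_intros r(1) n Z)
  qed
qed

lemma sz_append_ge: "sz xs \<le> sz (xs @ ys)" "sz ys \<le> sz (xs @ ys)"
proof -
  have "0 < sz xs" "0 < sz ys" by simp_all
  then show "sz xs \<le> sz (xs @ ys)" "sz ys \<le> sz (xs @ ys)" using sz_append[of xs ys] by linarith+
qed

lemma PT_comp2:
  assumes "PT sz (\<lambda>p. g (fst p) (snd p))" "PT M f1" "PT M f2"
  shows "PT M (\<lambda>x. g (f1 x) (f2 x))"
  using PT_comp[OF assms(1) PT_prod[OF assms(2,3)]] by simp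

lemma PT_comp3:
  assumes "PT sz (\<lambda>p. g (fst (fst p)) (snd (fst p)) (snd p))" "PT M f1" "PT M f2" "PT M f3"
  shows "PT M (\<lambda>x. g (f1 x) (f2 x) (f3 x))"
  using PT_comp[OF assms(1) PT_prod[OF PT_prod[OF assms(2,3)] assms(4)]] by simp

lemma PT_comp4:
  assumes "PT sz (\<lambda>p. g (fst (fst (fst p))) (snd (fst (fst p))) (snd (fst p)) (snd p))" "PT M f1" "PT M f2" "PT M f3" "PT M f4"
  shows "PT M (\<lambda>x. g (f1 x) (f2 x) (f3 x) (f4 x))"
  using PT_comp[OF assms(1) PT_prod[OF PT_prod[OF PT_prod[OF assms(2,3)] assms(4)] assms(5)]] by simp

lemma PT_Not [PT_intros]: "PT M f \<Longrightarrow> PT M (\<lambda>x. \<not> f x)"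
  by (rule PT_comp[of Not]) (rule PT_recode[of _ "\<lambda>b. if b then False else True"], intro PT_intros, auto)

lemma PT_conj [PT_intros]: "PT M f \<Longrightarrow> PT M g \<Longrightarrow> PT M (\<lambda>x. f x \<and> g x)"
  by (rule PT_comp2[of "(\<and>)"]) (rule PT_recode[of _ "\<lambda>p. if fst p then snd p else False"], intro PT_intros, auto)

lemma PT_disj [PT_intros]: "PT M f \<Longrightarrow> PT M g \<Longrightarrow> PT M (\<lambda>x. f x \<or> g x)"
  by (rule PT_comp2[of "(\<or>)"]) (rule PT_recode[of _ "\<lambda>p. if fst p then True else snd p"], intro PT_intros, auto)

text \<open>An iterated function sees only its state, so the loop state holds the unread list, the
  accumulator and the parameter \<open>x\<close>. The accumulators to be bounded are those reached
  after prefixes of the list.\<close>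

lemma PT_foldl:
  fixes b :: "'s::enc \<Rightarrow> 'y::enc \<Rightarrow> 'x::enc \<Rightarrow> 's"
  assumes b: "PT sz (\<lambda>p. b (fst (fst p)) (snd (fst p)) (snd p))"
    and i: "PT M i" and l: "PT M l" and Z: "poly_bounded M Z"
    and size: "\<And>x ys zs. l x = ys @ zs \<Longrightarrow> sz (foldl (\<lambda>a y. b a y x) (i x) ys) \<le> Z x"
  shows "PT M (\<lambda>x. foldl (\<lambda>a y. b a y x) (i x) (l x))"
proof -
  define P :: "('y list \<times> 's) \<times> 'x \<Rightarrow> bool" where
    "P = (\<lambda>st. case fst (fst st) of [] \<Rightarrow> False | y # ys \<Rightarrow> True)"
  define F :: "('y list \<times> 's) \<times> 'x \<Rightarrow> ('y list \<times> 's) \<times> 'x" where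
    "F = (\<lambda>st. case fst (fst st) of [] \<Rightarrow> st | y # ys \<Rightarrow> ((ys, b (snd (fst st)) y (snd st)), snd st))"
  define g where "g = (\<lambda>x. ((l x, i x), x))"
  have F: "(F ^^ j) (g x) = ((drop j (l x), foldl (\<lambda>a y. b a y x) (i x) (take j (l x))), x)" if "j \<le> length (l x)" for j x
    using that
  proof (induction j)
    case (Suc j)
    then have "drop j (l x) = l x ! j # drop (Suc j) (l x)" by (simp add: Cons_nth_drop_Suc)
    with Suc show ?case by (simp add: F_def take_Suc_conv_app_nth)
  qed (simp add: g_def)
  have "PT M (\<lambda>x. (F ^^ length (l x)) (g x))"
  proof (rule PT_while)
    show "PT sz P" unfolding P_def by (intro PT_intros)
    show "PT sz F" unfolding F_def by (intro PT_intros PT_comp3[OF b])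
    have idM: "PT M (\<lambda>x. x)" by (rule PT_id[OF PT_dom[OF i]])
    show "PT M g" unfolding g_def by (intro PT_intros i l idM)
    have "length (ys :: 'y list) \<le> sz ys" for ys by (induction ys) auto
    then show "poly_bounded M (\<lambda>x. length (l x))" using PT_size[OF l] by (blast intro: pb_le)
    show "poly_bounded M (\<lambda>x. Suc (Suc (sz (l x) + Z x) + sz x))"
      by (intro pb_intros PT_size l Z idM)
    show "sz ((F ^^ j) (g x)) \<le> Suc (Suc (sz (l x) + Z x) + sz x)" if "j \<le> length (l x)" for x j
    proof -
      have "sz (drop j (l x)) \<le> sz (l x)" using sz_append_ge(2)[of "drop j (l x)" "take j (l x)"] by simp
      then show ?thesis using size[of x "take j (l x)" "drop j (l x)"] by (simp add: F[OF that])
    qed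
    show "P ((F ^^ j) (g x))" if "j < length (l x)" for x j
      using that by (auto simp: F P_def split: list.split)
    show "\<not> P ((F ^^ length (l x)) (g x))" for x by (simp add: F P_def)
  qed
  from PT_snd[OF PT_fst[OF this]] show ?thesis by (simp add: F)
qed

lemma sz_rev [simp]: "sz (rev xs) = sz xs"
proof (induction xs)
  case (Cons x xs)
  then show ?case using sz_append[of "rev xs" "[x]"] by simp
qed simp

lemma PT_rev [PT_intros]:
  assumes "PT M l"
  shows "PT M (\<lambda>x. rev (l x))"
proof -
  have r: "foldl (\<lambda>a y. y # a) zs ys = rev ys @ zs" for zs ys :: "'b list"
    by (induction ys arbitrary: zs) auto
  have "PT sz (\<lambda>xs :: 'b list. foldl (\<lambda>a y. y # a) [] xs)"
  proof (rule PT_foldl[where Z = sz])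
    fix x ys zs :: "'b list" assume "x = ys @ zs"
    then show "sz (foldl (\<lambda>a y. y # a) [] ys) \<le> sz x"
      using sz_append_ge(1)[of ys zs] by (simp add: r)
  qed (intro PT_intros pb_intros)+
  then show ?thesis using PT_comp assms by (simp add: r)
qed

text \<open>Recursion from the right is a left fold over the reversed list. The fold also rebuilds
  the tail \<open>ys\<close>, which \<open>b\<close> may inspect, and size bounds are accordingly
  required for suffixes.\<close>

lemma PT_list_rec:
  fixes F :: "'e::enc \<Rightarrow> 'y::enc list \<Rightarrow> 'r::enc"
  assumes F: "\<And>e. F e [] = i e" "\<And>e y ys. F e (y # ys) = b y ys (F e ys) e"
    and i: "PT sz i" and b: "PT sz (\<lambda>p. b (fst (fst (fst p))) (snd (fst (fst p))) (snd (fst p)) (snd p))"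
    and e: "PT M e" and l: "PT M l" and Z: "poly_bounded M Z"
    and size: "\<And>x ys zs. l x = ys @ zs \<Longrightarrow> sz (F (e x) zs) \<le> Z x"
  shows "PT M (\<lambda>x. F (e x) (l x))"
proof -
  let ?B = "\<lambda>(a :: ('y list \<times> 'r) \<times> 'e) (y :: 'y) (x :: 'a).
    ((y # fst (fst a), b y (fst (fst a)) (snd (fst a)) (snd a)), snd a)"
  let ?I = "\<lambda>x. (([], i (e x)), e x)"
  have f: "foldl (\<lambda>a y. ?B a y x) (?I x) (rev ys) = ((ys, F (e x) ys), e x)" for x ys
    by (induction ys) (simp_all add: F)
  have "PT M (\<lambda>x. foldl (\<lambda>a y. ?B a y x) (?I x) (rev (l x)))"
  proof (rule PT_foldl[where Z = "\<lambda>x. Suc (Suc (sz (l x) + Z x) + sz (e x))"])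
    show "PT sz (\<lambda>p. ?B (fst (fst p)) (snd (fst p)) (snd p))" by (intro PT_intros PT_comp4[OF b])
    show "PT M ?I" by (intro PT_intros PT_comp[OF i] e PT_const[OF PT_dom[OF e]])
    show "PT M (\<lambda>x. rev (l x))" by (intro PT_intros l)
    show "poly_bounded M (\<lambda>x. Suc (Suc (sz (l x) + Z x) + sz (e x)))" by (intro pb_intros PT_size l e Z)
    fix x ys zs assume "rev (l x) = ys @ zs"
    then have l: "l x = rev zs @ rev ys" by (metis rev_append rev_rev_ident)
    have "foldl (\<lambda>a y. ?B a y x) (?I x) ys = ((rev ys, F (e x) (rev ys)), e x)" using f[of x "rev ys"] by simp
    then show "sz (foldl (\<lambda>a y. ?B a y x) (?I x) ys) \<le> Suc (Suc (sz (l x) + Z x) + sz (e x))"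
      using size[OF l] sz_append_ge(2)[of "rev ys" "rev zs"] by (simp add: l)
  qed
  from PT_snd[OF PT_fst[OF this]] show ?thesis by (simp add: f)
qed

section \<open>Binary arithmetic\<close>

definition nlen :: "nat \<Rightarrow> nat" where
  "nlen n = length (bin_digits n)"

lemma bin_digits_0 [simp]: "bin_digits 0 = []"
  by (simp add: bin_digits.simps)

lemma bin_digits_pos: "0 < n \<Longrightarrow> bin_digits n = odd n # bin_digits (n div 2)"
  by (subst bin_digits.simps) simp

lemma bin_digits_eq_Nil [simp]: "bin_digits n = [] \<longleftrightarrow> n = 0"
  by (cases "n = 0") (simp_all add: bin_digits_pos)

lemma bin_digits_Cons: "bin_digits n = d # ds \<Longrightarrow> 0 < n \<and> d = odd n \<and> ds = bin_digits (n div 2)"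
  by (cases "n = 0") (simp_all add: bin_digits_pos)

lemma bin_digits_double: "bin_digits (2 * n + of_bool b) = (if n = 0 \<and> \<not> b then [] else b # bin_digits n)"
  by (cases b; cases "n = 0") (simp_all add: bin_digits_pos)

lemma nlen_le: "nlen n \<le> k \<longleftrightarrow> n < 2 ^ k"
proof (induction k arbitrary: n)
  case (Suc k)
  show ?case
  proof (cases "n = 0")
    case False
    then have "nlen n \<le> Suc k \<longleftrightarrow> nlen (n div 2) \<le> k" by (simp add: nlen_def bin_digits_pos)
    then show ?thesis using Suc[of "n div 2"] by (simp add: div_less_iff_less_mult mult.commute)
  qed (simp add: nlen_def)
qed (simp add: nlen_def)

lemma less_pow_nlen: "n < 2 ^ nlen n"
  using nlen_le by blast

lemma sz_nat: "sz (n :: nat) = sz (bin_digits n)"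
  by (simp add: sz_def encd_nat_def)

lemma sz_bools: "sz (bs :: bool list) \<le> 4 * length bs + 1" "length bs < sz bs"
proof -
  show "sz bs \<le> 4 * length bs + 1"
  proof (induction bs)
    case (Cons b bs)
    then show ?case using sz_bool[of b] by simp
  qed simp
  show "length bs < sz bs" by (induction bs) auto
qed

lemma sz_nlen: "sz (n :: nat) \<le> 4 * nlen n + 1" "nlen n < sz n"
  using sz_bools[of "bin_digits n"] by (simp_all add: sz_nat nlen_def)

lemma nlen_mono: "m \<le> n \<Longrightarrow> nlen m \<le> nlen n"
  using less_pow_nlen[of n] by (simp add: nlen_le)

lemma sz_less_pow: "(n :: nat) < 2 ^ k \<Longrightarrow> sz n \<le> 4 * k + 1"
  using sz_nlen(1)[of n] nlen_le[of n k] by simp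

text \<open>\<open>sz\<close> is not monotone on numbers, since a digit 1 has a longer code than a
  digit 0; the detour over the number of digits costs the factor 4.\<close>

lemma sz_nat_mono: "m \<le> n \<Longrightarrow> sz m \<le> 4 * sz (n :: nat)"
  using sz_nlen(1)[of m] sz_nlen(2)[of n] nlen_mono[of m n] by simp

lemma sz_0 [simp]: "sz (0 :: nat) = 1"
  by (simp add: sz_nat)

lemma PT_bin_digits [PT_intros]: "PT M f \<Longrightarrow> PT M (\<lambda>x. bin_digits (f x))"
  by (erule PT_recode) (simp add: encd_nat_def)

lemma PT_from_digits: "PT M g \<Longrightarrow> (\<And>x. bin_digits (f x) = g x) \<Longrightarrow> PT M f"
  by (erule PT_recode) (simp add: encd_nat_def)

lemma PT_is_0 [PT_intros]:
  fixes f :: "'a::enc \<Rightarrow> nat"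
  assumes "PT M f"
  shows "PT M (\<lambda>x. f x = 0)"
proof -
  have "PT sz (\<lambda>n. case bin_digits n of [] \<Rightarrow> True | y # ys \<Rightarrow> False)" by (intro PT_intros)
  then have "PT sz (\<lambda>n :: nat. n = 0)" by (rule PT_recode) (auto split: list.split dest: bin_digits_Cons)
  then show ?thesis using assms by (rule PT_comp[of "\<lambda>n. n = 0"])
qed

lemma PT_double:
  assumes "PT M f" "PT M g"
  shows "PT M (\<lambda>x. 2 * f x + of_bool (g x) :: nat)"
proof -
  have "PT sz (\<lambda>p. if fst p = 0 \<and> \<not> snd p then [] else snd p # bin_digits (fst p))" by (intro PT_intros)
  then have "PT sz (\<lambda>p. 2 * fst p + of_bool (snd p) :: nat)"
    by (rule PT_from_digits) (simp add: bin_digits_double)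
  then show ?thesis using assms by (rule PT_comp2[where g = "\<lambda>n b. 2 * n + of_bool b"])
qed

lemma PT_mult_2 [PT_intros]: "PT M f \<Longrightarrow> PT M (\<lambda>x. 2 * f x :: nat)"
  and PT_mult_2_Suc [PT_intros]: "PT M f \<Longrightarrow> PT M (\<lambda>x. Suc (2 * f x))"
  using PT_double[OF _ PT_const[OF PT_dom, of M f False], of f] PT_double[OF _ PT_const[OF PT_dom, of M f True], of f]
  by (simp_all add: Suc_eq_plus1)

lemma PT_div_2 [PT_intros]:
  assumes "PT M f"
  shows "PT M (\<lambda>x. f x div 2 :: nat)"
proof -
  have "PT sz (\<lambda>n. case bin_digits n of [] \<Rightarrow> [] | d # ds \<Rightarrow> ds)" by (intro PT_intros)
  then have "PT sz (\<lambda>n :: nat. n div 2)"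
    by (rule PT_from_digits) (auto split: list.split dest: bin_digits_Cons)
  then show ?thesis using assms by (rule PT_comp)
qed

lemma PT_odd [PT_intros]:
  assumes "PT M f"
  shows "PT M (\<lambda>x. odd (f x :: nat))"
proof -
  have "PT sz (\<lambda>n. case bin_digits n of [] \<Rightarrow> False | d # ds \<Rightarrow> d)" by (intro PT_intros)
  then have "PT sz (\<lambda>n :: nat. odd n)"
    by (rule PT_recode) (auto split: list.split dest: bin_digits_Cons)
  then show ?thesis using assms by (rule PT_comp)
qed

text \<open>Halving drops the first digit, so this is list recursion on the digits. Sizes are
  required for all \<open>k\<close> up to \<open>m x\<close> because every suffix of the digits of a
  number denotes a number not above it.\<close>

lemma PT_nat_rec:
  fixes F :: "'e::enc \<Rightarrow> nat \<Rightarrow> 'r::enc"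
  assumes F: "\<And>e. F e 0 = i e" "\<And>e n. 0 < n \<Longrightarrow> F e n = b (odd n) (n div 2) (F e (n div 2)) e"
    and i: "PT sz i" and b: "PT sz (\<lambda>p. b (fst (fst (fst p))) (snd (fst (fst p))) (snd (fst p)) (snd p))"
    and e: "PT M e" and m: "PT M m" and Z: "poly_bounded M Z"
    and size: "\<And>x k. k \<le> m x \<Longrightarrow> sz (F (e x) k) \<le> Z x"
  shows "PT M (\<lambda>x. F (e x) (m x))"
proof -
  \<comment> \<open>The first component rebuilds the number from its digits, because
    \<open>b\<close> receives \<open>n div 2\<close> as a number and not as a digit list.\<close>
  define G where "G e ds = rec_list (0 :: nat, i e) (\<lambda>d ds r. (2 * fst r + of_bool d, b d (fst r) (snd r) e)) ds" for e ds
  have G: "G e (bin_digits n) = (n, F e n)" for e n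
    by (induction n rule: less_induct)
       (subst bin_digits.simps, auto simp: G_def F)
  have "PT M (\<lambda>x. G (e x) (bin_digits (m x)))"
  proof (rule PT_list_rec[where i = "\<lambda>e. (0, i e)" and b = "\<lambda>d ds r e. (2 * fst r + of_bool d, b d (fst r) (snd r) e)"
      and Z = "\<lambda>x. Suc (4 * sz (m x) + Z x)"])
    show "PT sz (\<lambda>e. (0 :: nat, i e))" by (intro PT_intros PT_comp[OF i])
    show "PT sz (\<lambda>p. (2 * fst (snd (fst p)) + of_bool (fst (fst (fst p))) :: nat,
      b (fst (fst (fst p))) (fst (snd (fst p))) (snd (snd (fst p))) (snd p)))" for ds :: "bool list"
      by (intro PT_intros PT_double PT_comp4[OF b])
    show "PT M (\<lambda>x. bin_digits (m x))" by (intro PT_intros m)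
    show "poly_bounded M (\<lambda>x. Suc (4 * sz (m x) + Z x))" by (intro pb_intros PT_size m Z)
    fix x ys zs assume "bin_digits (m x) = ys @ zs"
    moreover have "\<exists>k \<le> n. zs = bin_digits k" if "bin_digits n = ys @ zs" for n
      using that
    proof (induction ys arbitrary: n)
      case (Cons y ys)
      then have "bin_digits (n div 2) = ys @ zs" using bin_digits_Cons[of n y "ys @ zs"] by simp
      from Cons.IH[OF this] obtain k where "k \<le> n div 2" "zs = bin_digits k" by blast
      then show ?case using div_le_dividend[of n 2] by (intro exI[of _ k]) linarith
    qed auto
    ultimately obtain k where k: "k \<le> m x" "zs = bin_digits k" by blast
    show "sz (G (e x) zs) \<le> Suc (4 * sz (m x) + Z x)"
      using size[OF k(1)] sz_nat_mono[OF k(1)] by (simp add: k(2) G)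
  qed (use e in \<open>simp_all add: G_def\<close>)
  from PT_snd[OF this] show ?thesis by (simp add: G)
qed

lemma PT_Suc [PT_intros]:
  assumes "PT M f"
  shows "PT M (\<lambda>x. Suc (f x))"
proof -
  have "PT sz (\<lambda>n :: nat. (\<lambda>_ n. (n, Suc n)) n n)"
  proof (rule PT_nat_rec[where e = "\<lambda>n. n" and F = "\<lambda>(_ :: nat) n. (n, Suc n)" and i = "\<lambda>_. (0, Suc (2 * 0))" and Z = "\<lambda>n. Suc (4 * sz n + 4 * sz (Suc (2 * n)))" and
      b = "\<lambda>d m r e. if d then (Suc (2 * fst r), 2 * snd r) else (2 * m, Suc (2 * m))"])
    show "(n, Suc n) = (if odd n then (Suc (2 * fst (n div 2, Suc (n div 2))), 2 * snd (n div 2, Suc (n div 2)))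
        else (2 * (n div 2), Suc (2 * (n div 2))))" for n :: nat
      by (cases "odd n") (auto elim!: oddE)
    show "poly_bounded sz (\<lambda>n :: nat. Suc (4 * sz n + 4 * sz (Suc (2 * n))))"
      by (intro pb_intros PT_size PT_intros)
    fix x k :: nat assume "k \<le> x"
    then show "sz (k, Suc k) \<le> Suc (4 * sz x + 4 * sz (Suc (2 * x)))"
      using sz_nat_mono[of k x] sz_nat_mono[of "Suc k" "Suc (2 * x)"] by simp
  qed (intro PT_intros | simp)+
  from PT_snd[OF this] have "PT sz Suc" by simp
  then show ?thesis using assms by (rule PT_comp)
qed

lemma PT_pred [PT_intros]:
  assumes "PT M f"
  shows "PT M (\<lambda>x. f x - 1 :: nat)"
proof -
  have "PT sz (\<lambda>n :: nat. (\<lambda>_ n. n - 1) n n)"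
  proof (rule PT_nat_rec[where e = "\<lambda>n. n" and F = "\<lambda>(_ :: nat) n. n - 1" and i = "\<lambda>_. 0" and Z = "\<lambda>n. 4 * sz n" and
      b = "\<lambda>d m r e. if d then 2 * m else Suc (2 * r)"])
    show "n - 1 = (if odd n then 2 * (n div 2) else Suc (2 * (n div 2 - 1)))" if "0 < n" for n :: nat
      using that by presburger
    show "poly_bounded sz (\<lambda>n :: nat. 4 * sz n)" by (intro pb_intros PT_size PT_intros)
    fix x k :: nat assume "k \<le> x"
    then show "sz (k - 1) \<le> 4 * sz x" by (intro sz_nat_mono) simp
  qed (intro PT_intros | simp)+
  then show ?thesis using assms by (rule PT_comp[of "\<lambda>n :: nat. n - 1"])
qed

section \<open>Addition, subtraction, multiplication and division of binary numbers\<close>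

declare One_nat_def [simp]

text \<open>Horner's scheme, most significant digit first. The start value allows digits produced so
  far to be attached below the unprocessed upper part of an operand.\<close>

definition from_digits :: "nat \<Rightarrow> bool list \<Rightarrow> nat" where
  "from_digits n ds = foldl (\<lambda>n d. 2 * n + of_bool d) n ds"

lemma from_digits_simps [simp]:
  "from_digits n [] = n" "from_digits n (d # ds) = from_digits (2 * n + of_bool d) ds"
  by (simp_all add: from_digits_def)

lemma from_digits_rev: "from_digits 0 (rev (bin_digits n)) = n"
proof (induction n rule: less_induct)
  case (less n)
  show ?case
  proof (cases "n = 0")
    case False
    then show ?thesis using less[of "n div 2"] by (simp add: bin_digits_pos from_digits_def)
  qed simp
qed

lemma from_digits_bound: "n < 2 ^ k \<Longrightarrow> from_digits n ds < 2 ^ (k + length ds)"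
proof (induction ds arbitrary: n k)
  case (Cons d ds)
  have "2 * n + of_bool d < 2 ^ Suc k" using Cons.prems by (cases d) auto
  from Cons.IH[OF this] show ?case by simp
qed simp

lemma PT_from_digits_rec [PT_intros]:
  assumes "PT M f" "PT M g"
  shows "PT M (\<lambda>x. from_digits (f x) (g x))"
proof -
  have "PT sz (\<lambda>p. foldl (\<lambda>n d. 2 * n + of_bool d :: nat) (fst p) (snd p))"
  proof (rule PT_foldl[where Z = "\<lambda>p. 4 * (nlen (fst p) + length (snd p)) + 1"])
    show "PT sz (\<lambda>p :: (nat \<times> bool) \<times> nat \<times> bool list. 2 * fst (fst p) + of_bool (snd (fst p)) :: nat)"
      by (intro PT_double PT_intros)
    show "poly_bounded sz (\<lambda>p. 4 * (nlen (fst p) + length (snd p :: bool list)) + 1)"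
    proof (rule pb_le)
      show "poly_bounded sz (\<lambda>p :: nat \<times> bool list. 4 * (sz (fst p) + sz (snd p)) + 1)"
        by (intro pb_intros PT_size PT_intros)
      show "4 * (nlen (fst p) + length (snd p)) + 1 \<le> 4 * (sz (fst p) + sz (snd p)) + 1" for p :: "nat \<times> bool list"
        using sz_nlen(2)[of "fst p"] sz_bools(2)[of "snd p"] by simp
    qed
    fix p :: "nat \<times> bool list" and ys zs assume "snd p = ys @ zs"
    then have "from_digits (fst p) ys < 2 ^ (nlen (fst p) + length (snd p))"
      using from_digits_bound[OF less_pow_nlen, of "fst p" ys]
      by (elim order_less_le_trans) (simp add: power_increasing)
    from sz_less_pow[OF this] show "sz (foldl (\<lambda>n d. 2 * n + of_bool d) (fst p) ys) \<le> 4 * (nlen (fst p) + length (snd p)) + 1"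
      by (simp add: from_digits_def)
  qed (intro PT_intros)+
  then have "PT sz (\<lambda>p. from_digits (fst p) (snd p))" by (simp add: from_digits_def)
  then show ?thesis using assms by (rule PT_comp2)
qed

text \<open>The state consists of the unread part of the first operand, the carry or borrow,
  and the digits of the result, the most significant one first; \<open>neg\<close> selects subtraction.\<close>

definition add_step :: "bool \<Rightarrow> (nat \<times> bool) \<times> bool list \<Rightarrow> bool \<Rightarrow> (nat \<times> bool) \<times> bool list" where
  "add_step neg s d = (let a = odd (fst (fst s)); c = snd (fst s); a' = (if neg then \<not> a else a) in
     ((fst (fst s) div 2, a' \<and> d \<or> a' \<and> c \<or> d \<and> c),
      (if a then (if d then c else \<not> c) else (if d then \<not> c else c)) # snd s))"

fun digits_value :: "bool list \<Rightarrow> nat" where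
  "digits_value [] = 0"
| "digits_value (d # ds) = 2 * digits_value ds + of_bool d"

lemma digits_value_bin_digits [simp]: "digits_value (bin_digits n) = n"
proof (induction n rule: less_induct)
  case (less n)
  show ?case
  proof (cases "n = 0")
    case False
    then show ?thesis using less[of "n div 2"] by (simp add: bin_digits_pos)
  qed simp
qed

text \<open>The right-hand side is a loop invariant: at each position the sum of the three bits is
  twice their majority, the new carry, plus their parity, the output digit.\<close>

lemma foldl_add_step:
  "(let s = foldl (add_step False) ((a, c), out) ds in from_digits (fst (fst s) + of_bool (snd (fst s))) (snd s))
   = from_digits (a + of_bool c + digits_value ds) out"
proof (induction ds arbitrary: a c out)
  case (Cons d ds)
  let ?c = "\<lambda>e. e \<and> d \<or> e \<and> c \<or> d \<and> c" and ?t = "\<lambda>e. if e then (if d then c else \<not> c) else (if d then \<not> c else c)"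
  have step: "add_step False ((a, c), out) d = ((a div 2, ?c (odd a)), ?t (odd a) # out)"
    by (simp add: add_step_def Let_def)
  have digit: "2 * (m + of_bool (?c e) + v) + of_bool (?t e) = (2 * m + of_bool e) + of_bool c + (2 * v + of_bool d)"
    for m v :: nat and e by (cases e; cases d; cases c; simp)
  have a: "2 * (a div 2) + of_bool (odd a) = a" by simp
  show ?case using Cons[of "a div 2" "?c (odd a)" "?t (odd a) # out"]
    by (simp only: foldl_Cons step digits_value.simps from_digits_simps digit a)
qed (simp add: Let_def)

text \<open>The borrow is the majority with the digit of \<open>a\<close> negated; the output digit
  is again the parity. The true difference is negative exactly if a borrow remains when
  \<open>a\<close> is used up, and then truncated subtraction gives 0.\<close>

lemma foldl_sub_step:
  "(let s = foldl (add_step True) ((a, c), out) ds in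
      if fst (fst s) = 0 \<and> snd (fst s) then 0 else from_digits (fst (fst s) - of_bool (snd (fst s))) (snd s))
   = (if a < of_bool c + digits_value ds then 0 else from_digits (a - (of_bool c + digits_value ds)) out)"
proof (induction ds arbitrary: a c out)
  case (Cons d ds)
  let ?c = "\<lambda>e. \<not> e \<and> d \<or> \<not> e \<and> c \<or> d \<and> c" and ?t = "\<lambda>e. if e then (if d then c else \<not> c) else (if d then \<not> c else c)"
  have step: "add_step True ((a, c), out) d = ((a div 2, ?c (odd a)), ?t (odd a) # out)"
    by (simp add: add_step_def Let_def)
  have less: "m < of_bool (?c e) + v \<longleftrightarrow> 2 * m + of_bool e < of_bool c + (2 * v + of_bool d)"
    for m v :: nat and e by (cases e; cases d; cases c; simp; arith)
  have digit: "2 * (m - (of_bool (?c e) + v)) + of_bool (?t e) = (2 * m + of_bool e) - (of_bool c + (2 * v + of_bool d))"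
    if "\<not> 2 * m + of_bool e < of_bool c + (2 * v + of_bool d)" for m v :: nat and e
    using that by (cases e; cases d; cases c; simp; arith)
  have a: "2 * (a div 2) + of_bool (odd a) = a" by simp
  show ?case
  proof (cases "a < of_bool c + (2 * digits_value ds + of_bool d)")
    case True
    then show ?thesis using Cons[of "a div 2" "?c (odd a)" "?t (odd a) # out"] less[of "a div 2" "odd a" "digits_value ds"]
      by (simp only: foldl_Cons step digits_value.simps a if_True)
  next
    case False
    note digit' = digit[of "a div 2" "odd a" "digits_value ds", unfolded a, OF False]
    from False show ?thesis using Cons[of "a div 2" "?c (odd a)" "?t (odd a) # out"] less[of "a div 2" "odd a" "digits_value ds"]
      by (simp only: foldl_Cons step digits_value.simps a if_False from_digits_simps digit')
  qed
qed (auto simp: Let_def)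

lemma PT_foldl_add_step:
  assumes "PT M f" "PT M g"
  shows "PT M (\<lambda>x. foldl (add_step neg) ((f x, False), []) (bin_digits (g x)))"
proof -
  have "PT sz (\<lambda>p. foldl (\<lambda>s d. add_step neg s d) ((fst p, False), []) (bin_digits (snd p)))"
  proof (rule PT_foldl[where Z = "\<lambda>p. Suc (Suc (4 * sz (fst p) + 3) + (4 * sz (snd p) + 1))"])
    show "PT sz (\<lambda>p :: (((nat \<times> bool) \<times> bool list) \<times> bool) \<times> nat \<times> nat. add_step neg (fst (fst p)) (snd (fst p)))"
      unfolding add_step_def Let_def by (intro PT_intros)
    show "poly_bounded sz (\<lambda>p. Suc (Suc (4 * sz (fst p :: nat) + 3) + (4 * sz (snd p :: nat) + 1)))"
      by (intro pb_intros PT_size PT_intros)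
    fix p :: "nat \<times> nat" and ys zs assume l: "bin_digits (snd p) = ys @ zs"
    have "fst (fst (foldl (add_step neg) ((a, c), out) ys)) \<le> a \<and> length (snd (foldl (add_step neg) ((a, c), out) ys)) = length out + length ys" for a c out
    proof (induction ys arbitrary: a c out)
      case (Cons y ys)
      obtain c' t where "add_step neg ((a, c), out) y = ((a div 2, c'), t # out)" by (simp add: add_step_def Let_def)
      then show ?case using Cons[of "a div 2" c' "t # out"] div_le_dividend[of a 2] by (auto intro: order_trans)
    qed simp
    from this[of "fst p" False "[]"] obtain a c out where s: "foldl (add_step neg) ((fst p, False), []) ys = ((a, c), out)"
      "a \<le> fst p" "length out = length ys" by (metis prod.collapse list.size(3) add_0)
    have "length ys \<le> nlen (snd p)" by (simp add: nlen_def l)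
    then show "sz (foldl (\<lambda>s d. add_step neg s d) ((fst p, False), []) ys) \<le> Suc (Suc (4 * sz (fst p) + 3) + (4 * sz (snd p) + 1))"
      using s(3) sz_nat_mono[OF s(2)] sz_bool[of c] sz_bools(1)[of out] sz_nlen(2)[of "snd p"] by (simp add: s(1))
  qed (intro PT_intros)+
  then show ?thesis using assms by (rule PT_comp2[where g = "\<lambda>a b. foldl (\<lambda>s d. add_step neg s d) ((a, False), []) (bin_digits b)"])
qed

lemma PT_plus [PT_intros]:
  assumes "PT M f" "PT M g"
  shows "PT M (\<lambda>x. f x + g x :: nat)"
proof -
  let ?s = "\<lambda>x. foldl (add_step False) ((f x, False), []) (bin_digits (g x))"
  have "f x + g x = from_digits (if snd (fst (?s x)) then Suc (fst (fst (?s x))) else fst (fst (?s x))) (snd (?s x))" for x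
    using foldl_add_step[of "f x" False "[]" "bin_digits (g x)"] by (cases "snd (fst (?s x))") (simp_all add: Let_def split: if_splits)
  then show ?thesis by (simp only:) (intro PT_intros PT_foldl_add_step assms)
qed

lemma PT_minus [PT_intros]:
  assumes "PT M f" "PT M g"
  shows "PT M (\<lambda>x. f x - g x :: nat)"
proof -
  let ?s = "\<lambda>x. foldl (add_step True) ((f x, False), []) (bin_digits (g x))"
  have "f x - g x = (if fst (fst (?s x)) = 0 \<and> snd (fst (?s x)) then 0
    else from_digits (if snd (fst (?s x)) then fst (fst (?s x)) - 1 else fst (fst (?s x))) (snd (?s x)))" for x
    using foldl_sub_step[of "f x" False "[]" "bin_digits (g x)"] by (cases "snd (fst (?s x))") (simp_all add: Let_def split: if_splits)
  then show ?thesis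
    by (simp only:) (intro PT_intros PT_foldl_add_step assms PT_const[OF PT_dom[OF assms(1)]])
qed

lemma PT_le [PT_intros]: "PT M f \<Longrightarrow> PT M g \<Longrightarrow> PT M (\<lambda>x. f x \<le> (g x :: nat))"
  unfolding diff_is_0_eq[symmetric] by (intro PT_intros)

lemma PT_nat_eq [PT_intros]: "PT M f \<Longrightarrow> PT M g \<Longrightarrow> PT M (\<lambda>x. f x = (g x :: nat))"
  unfolding eq_iff[of "_ :: nat"] by (intro PT_intros)

lemma nlen_times: "nlen (a * b) \<le> nlen a + nlen b"
  unfolding nlen_le power_add using less_pow_nlen by (intro mult_strict_mono') auto

lemma PT_times [PT_intros]:
  assumes "PT M f" "PT M g"
  shows "PT M (\<lambda>x. f x * g x :: nat)"
proof -
  have "PT sz (\<lambda>p. (\<lambda>a n. a * n :: nat) (fst p) (snd p))"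
  proof (rule PT_nat_rec[where e = fst and m = snd and F = "\<lambda>a n. a * n" and i = "\<lambda>_. 0" and Z = "\<lambda>p. 4 * (sz (fst p) + sz (snd p)) + 1" and
      b = "\<lambda>d m r a. if d then 2 * r + a else 2 * r"])
    show "a * n = (if odd n then 2 * (a * (n div 2)) + a else 2 * (a * (n div 2)))" for a n :: nat
    proof -
      have "a * n = a * (2 * (n div 2) + of_bool (odd n))" by simp
      also have "\<dots> = (if odd n then 2 * (a * (n div 2)) + a else 2 * (a * (n div 2)))"
        unfolding distrib_left by (cases "odd n") simp_all
      finally show ?thesis .
    qed
    fix p :: "nat \<times> nat" and k assume "k \<le> snd p"
    then have "nlen (fst p * k) \<le> nlen (fst p) + nlen (snd p)"
      using nlen_times[of "fst p" k] nlen_mono[of k "snd p"] by simp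
    then show "sz (fst p * k) \<le> 4 * (sz (fst p) + sz (snd p)) + 1"
      using sz_nlen(1)[of "fst p * k"] sz_nlen(2)[of "fst p"] sz_nlen(2)[of "snd p"] by simp
  qed (intro PT_intros pb_intros PT_size PT_fst_sz PT_snd_sz | simp)+
  then show ?thesis using assms by (rule PT_comp2)
qed

text \<open>Long division: passing from \<open>n div 2\<close> to \<open>n\<close> doubles quotient
  and remainder and brings down one digit. Divisor 0 is treated apart, because comparison with 0
  would produce quotient digit 1 at every step.\<close>

lemma PT_divmod:
  assumes "PT M f" "PT M g"
  shows "PT M (\<lambda>x. if g x = 0 then (0, 0) else (f x div g x, f x mod g x :: nat))"
proof -
  have "PT sz (\<lambda>p. (\<lambda>a n. if a = 0 then (0, 0) else (n div a, n mod a :: nat)) (snd p) (fst p))"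
  proof (rule PT_nat_rec[where e = snd and m = fst and F = "\<lambda>a n. if a = 0 then (0, 0) else (n div a, n mod a)" and i = "\<lambda>_. (0, 0)" and Z = "\<lambda>p. 3 + (4 * sz (fst p) + 4 * sz (fst p))" and
      b = "\<lambda>d m r a. if a = 0 then (0, 0) else if a \<le> (if d then Suc (2 * snd r) else 2 * snd r)
         then (Suc (2 * fst r), (if d then Suc (2 * snd r) else 2 * snd r) - a) else (2 * fst r, if d then Suc (2 * snd r) else 2 * snd r)"])
    fix a n :: nat
    let ?r = "if a = 0 then (0, 0) else (n div 2 div a, n div 2 mod a)"
    have "(n div a, n mod a) = (if a \<le> r then (Suc (2 * q), r - a) else (2 * q, r))"
      if "a \<noteq> 0" "q = n div 2 div a" "r = (if odd n then Suc (2 * (n div 2 mod a)) else 2 * (n div 2 mod a))" for q r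
    proof -
      have n2: "n div 2 = a * q + n div 2 mod a" by (simp add: that(2))
      define e where "e = odd n"
      have "n = 2 * (n div 2) + (if e then 1 else 0)" by (simp add: e_def)
      then have "n = 2 * (a * q) + r" using n2 that(3)[folded e_def]
        by (cases e; simp only: if_True if_False; linarith)
      then have n: "n = a * (2 * q) + r" by simp
      have "n div 2 mod a < a" using that(1) by simp
      \<comment> \<open>Hence one conditional subtraction brings the remainder below
        \<open>a\<close> again.\<close>
      then have r: "r < 2 * a" using that(3) by (simp split: if_splits)
      show ?thesis
      proof (cases "a \<le> r")
        case True
        then have "n = a * Suc (2 * q) + (r - a)" "r - a < a" using n r by auto
        then show ?thesis using True that(1) by (metis div_mult_self4 div_less add_0_right mod_mult_self4 mod_less)
      next
        case False
        then have "n div a = 2 * q" "n mod a = r" using that(1) by (subst n, simp)+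
        then show ?thesis using False by simp
      qed
    qed
    then show "(if a = 0 then (0, 0) else (n div a, n mod a)) = (if a = 0 then (0, 0)
      else if a \<le> (if odd n then Suc (2 * snd ?r) else 2 * snd ?r)
         then (Suc (2 * fst ?r), (if odd n then Suc (2 * snd ?r) else 2 * snd ?r) - a)
         else (2 * fst ?r, if odd n then Suc (2 * snd ?r) else 2 * snd ?r))"
      by simp
  next
    fix p :: "nat \<times> nat" and k assume k: "k \<le> fst p"
    have "k div snd p \<le> fst p" "k mod snd p \<le> fst p"
      using k div_le_dividend[of k "snd p"] mod_less_eq_dividend[of k "snd p"] by linarith+
    then show "sz (if snd p = 0 then (0, 0) else (k div snd p, k mod snd p)) \<le> 3 + (4 * sz (fst p) + 4 * sz (fst p))"
      using sz_nat_mono[of "k div snd p" "fst p"] sz_nat_mono[of "k mod snd p" "fst p"] by simp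
  qed (intro PT_intros pb_intros PT_size PT_fst_sz PT_snd_sz | simp)+
  then show ?thesis using assms by (rule PT_comp2[where g = "\<lambda>n a. if a = 0 then (0, 0) else (n div a, n mod a)"])
qed

section \<open>Lists and encodings\<close>

lemma PT_append [PT_intros]:
  assumes "PT M f" "PT M g"
  shows "PT M (\<lambda>x. f x @ g x)"
proof -
  have "PT M (\<lambda>x. (\<lambda>zs ys. ys @ zs) (g x) (f x))"
  proof (rule PT_list_rec[where F = "\<lambda>zs ys. ys @ zs" and e = g and l = f and i = "\<lambda>e. e" and b = "\<lambda>y ys r e. y # r" and Z = "\<lambda>x. sz (f x) + sz (g x)"])
    fix x ys zs assume "f x = ys @ zs"
    then show "sz (zs @ g x) \<le> sz (f x) + sz (g x)" using sz_append[of zs "g x"] sz_append_ge(2)[of zs ys] by simp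
  qed (intro PT_intros pb_intros PT_size assms | simp)+
  then show ?thesis .
qed

lemma PT_tl [PT_intros]:
  assumes "PT M f"
  shows "PT M (\<lambda>x. tl (f x))"
proof -
  have "tl (f x) = (case f x of [] \<Rightarrow> [] | y # ys \<Rightarrow> ys)" for x by (cases "f x") auto
  then show ?thesis by (simp only:) (intro PT_intros assms PT_const[OF PT_dom[OF assms]])
qed

lemma PT_is_Nil [PT_intros]:
  assumes "PT M f"
  shows "PT M (\<lambda>x. f x = [])"
proof -
  have "(f x = []) = (case f x of [] \<Rightarrow> True | y # ys \<Rightarrow> False)" for x by (cases "f x") auto
  then show ?thesis by (simp only:) (intro PT_intros assms PT_const[OF PT_dom[OF assms]])
qed

definition hd0 :: "nat list \<Rightarrow> nat" where
  "hd0 l = (case l of [] \<Rightarrow> 0 | y # ys \<Rightarrow> y)"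

lemma hd0_simps [simp]: "hd0 [] = 0" "hd0 (y # ys) = y"
  by (simp_all add: hd0_def)

lemma PT_hd0 [PT_intros]: "PT M f \<Longrightarrow> PT M (\<lambda>x. hd0 (f x))"
  by (rule PT_comp[of hd0], unfold hd0_def) (intro PT_intros)

lemma sz_hd0: "sz (hd0 l) \<le> sz l"
  by (cases l) auto

lemma sz_tl: "sz (tl l) \<le> sz l"
  by (cases l) auto

lemma PT_length [PT_intros]:
  assumes "PT M l"
  shows "PT M (\<lambda>x. length (l x))"
proof -
  have len: "length (ys :: 'b list) \<le> sz ys" for ys by (induction ys) auto
  have "PT M (\<lambda>x. (\<lambda>(_ :: 'a) ys. length ys) x (l x))"
  proof (rule PT_list_rec[where F = "\<lambda>(_ :: 'a) ys. length ys" and e = "\<lambda>x. x" and i = "\<lambda>e. 0" and b = "\<lambda>y ys r e. Suc r" and Z = "\<lambda>x. 4 * sz (l x) + 1"])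
    fix x ys zs assume "l x = ys @ zs"
    then have "length zs \<le> sz (l x)" using len[of "l x"] by simp
    then have "length zs < 2 ^ sz (l x)" using less_exp order_le_less_trans by blast
    then show "sz (length zs) \<le> 4 * sz (l x) + 1" by (rule sz_less_pow)
  qed (intro PT_intros pb_intros PT_size assms PT_id[OF PT_dom[OF assms]] | simp)+
  then show ?thesis .
qed

definition match_step :: "bool list \<times> bool \<Rightarrow> bool \<Rightarrow> bool list \<times> bool" where
  "match_step s y = (case fst s of [] \<Rightarrow> ([], False) | z # zs \<Rightarrow> (zs, snd s \<and> (if y then z else \<not> z)))"

lemma foldl_match_step:
  "(let s = foldl match_step (zs, c) ys in fst s = [] \<and> snd s) \<longleftrightarrow> c \<and> zs = ys"
proof (induction ys arbitrary: zs c)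
  case (Cons y ys)
  show ?case
  proof (cases zs)
    case Nil
    then show ?thesis using Cons[of "[]" False] by (simp add: match_step_def)
  next
    case (Cons z zs')
    then show ?thesis using Cons.IH[of zs' "c \<and> (if y then z else \<not> z)"] by (auto simp: match_step_def)
  qed
qed (simp add: Let_def conj_commute)

lemma PT_bools_eq [PT_intros]:
  assumes "PT M f" "PT M g"
  shows "PT M (\<lambda>x. f x = (g x :: bool list))"
proof -
  have idM: "PT M (\<lambda>x. x)" by (rule PT_id[OF PT_dom[OF assms(1)]])
  have "PT M (\<lambda>x. foldl (\<lambda>s y. match_step s y) (f x, True) (g x))"
  proof (rule PT_foldl[where Z = "\<lambda>x. Suc (sz (f x) + 3)"])
    show "PT sz (\<lambda>p :: ((bool list \<times> bool) \<times> bool) \<times> 'a. match_step (fst (fst p)) (snd (fst p)))"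
      unfolding match_step_def by (intro PT_intros)
    fix x ys zs assume "g x = ys @ zs"
    have "sz (fst (foldl match_step (us, c) ys)) \<le> sz us" for us c
    proof (induction ys arbitrary: us c)
      case (Cons y ys)
      show ?case using Cons[of "fst (match_step (us, c) y)" "snd (match_step (us, c) y)"]
        by (cases us) (auto simp: match_step_def split: if_splits)
    qed simp
    from this[of "f x" True] show "sz (foldl (\<lambda>s y. match_step s y) (f x, True) ys) \<le> Suc (sz (f x) + 3)"
      using sz_bool[of "snd (foldl match_step (f x, True) ys)"] by (simp add: sz_pair)
  qed (intro PT_intros pb_intros PT_size assms PT_const[OF PT_dom[OF assms(1)]])+
  then have "PT M (\<lambda>x. let s = foldl match_step (f x, True) (g x) in fst s = [] \<and> snd s)"
    unfolding Let_def by (intro PT_intros)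
  then show ?thesis by (simp add: foldl_match_step)
qed

section \<open>Encoding, tokenising and parsing the input\<close>

lemma enc_nat_0: "enc_nat 0 = [True, True]"
  by (simp add: enc_nat_def)

lemma enc_nat_pos: "0 < n \<Longrightarrow> enc_nat n = False # odd n # enc_nat (n div 2)"
  by (simp add: enc_nat_def bin_digits_pos)

lemma length_enc_nat: "length (enc_nat n) = 2 * nlen n + 2"
proof -
  have "length (concat (map (\<lambda>b. [False, b]) ds)) = 2 * length ds" for ds by (induction ds) auto
  then show ?thesis by (simp add: enc_nat_def nlen_def)
qed

lemma PT_enc_nat [PT_intros]:
  assumes "PT M f"
  shows "PT M (\<lambda>x. enc_nat (f x))"
proof -
  have "PT M (\<lambda>x. (\<lambda>(_ :: 'a) n. enc_nat n) x (f x))"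
  proof (rule PT_nat_rec[where F = "\<lambda>(_ :: 'a) n. enc_nat n" and e = "\<lambda>x. x" and i = "\<lambda>e. [True, True]" and b = "\<lambda>d m r e. False # d # r" and Z = "\<lambda>x. 8 * sz (f x) + 9"])
    fix x k assume "k \<le> f x"
    then show "sz (enc_nat k) \<le> 8 * sz (f x) + 9"
      using sz_bools(1)[of "enc_nat k"] nlen_mono[of k "f x"] sz_nlen(2)[of "f x"] by (simp add: length_enc_nat)
  qed (intro PT_intros pb_intros PT_size assms PT_id[OF PT_dom[OF assms]] | simp add: enc_nat_0 enc_nat_pos)+
  then show ?thesis .
qed

text \<open>Labels, gate counts and list lengths are all written by \<open>enc_nat\<close>, so a
  whole input is a concatenation of such words and parsing reduces to grouping a list of
  numbers.\<close>

definition enc_nats :: "nat list \<Rightarrow> bool list" where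
  "enc_nats ts = concat (map enc_nat ts)"

lemma enc_nats_simps [simp]:
  "enc_nats [] = []" "enc_nats (t # ts) = enc_nat t @ enc_nats ts" "enc_nats (ts @ us) = enc_nats ts @ enc_nats us"
  by (simp_all add: enc_nats_def)

lemma PT_enc_nats [PT_intros]:
  assumes "PT M f"
  shows "PT M (\<lambda>x. enc_nats (f x))"
proof -
  have len: "length (enc_nats ts) \<le> 2 * sz ts" for ts
  proof (induction ts)
    case (Cons t ts)
    then show ?case using sz_nlen(2)[of t] by (simp add: length_enc_nat)
  qed simp
  have "PT M (\<lambda>x. (\<lambda>(_ :: 'a) ts. enc_nats ts) x (f x))"
  proof (rule PT_list_rec[where F = "\<lambda>(_ :: 'a) ts. enc_nats ts" and e = "\<lambda>x. x" and i = "\<lambda>e. []" and b = "\<lambda>y ys r e. enc_nat y @ r" and Z = "\<lambda>x. 8 * sz (f x) + 1"])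
    fix x ys zs assume "f x = ys @ zs"
    then show "sz (enc_nats zs) \<le> 8 * sz (f x) + 1"
      using sz_bools(1)[of "enc_nats zs"] len[of zs] sz_append_ge(2)[of zs ys] by simp
  qed (intro PT_intros pb_intros PT_size assms PT_id[OF PT_dom[OF assms]] | simp)+
  then show ?thesis .
qed

text \<open>The state holds the first bit of an incomplete pair, the digits of the current number (the last one read
  in front), and the numbers read so far.\<close>

definition token_step :: "(bool list \<times> bool list) \<times> nat list \<Rightarrow> bool \<Rightarrow> (bool list \<times> bool list) \<times> nat list" where
  "token_step s b = (case fst (fst s) of [] \<Rightarrow> (([b], snd (fst s)), snd s)
     | h # hs \<Rightarrow> if h then (([], []), from_digits 0 (snd (fst s)) # snd s) else (([], b # snd (fst s)), snd s))"

definition tokens :: "bool list \<Rightarrow> nat list" where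
  "tokens x = rev (snd (foldl token_step (([], []), []) x))"

text \<open>Digits arrive least significant first and are stacked, hence stand in the order that
  \<open>from_digits\<close> expects when a pair starting with \<open>True\<close> closes the
  number.\<close>

lemma tokens_enc_nats: "tokens (enc_nats ts) = ts"
proof -
  have digits: "foldl token_step (([], cur), out) (concat (map (\<lambda>b. [False, b]) ds)) = (([], rev ds @ cur), out)" for ds cur out
    by (induction ds arbitrary: cur) (simp_all add: token_step_def)
  have one: "foldl token_step (([], []), out) (enc_nat n) = (([], []), n # out)" for n out
    by (simp add: enc_nat_def digits) (simp add: token_step_def from_digits_rev)
  have "foldl token_step (([], []), out) (enc_nats ts) = (([], []), rev ts @ out)" for out
    by (induction ts arbitrary: out) (simp_all add: one)
  then show ?thesis by (simp add: tokens_def)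
qed

lemma PT_tokens [PT_intros]:
  assumes "PT M f"
  shows "PT M (\<lambda>x. tokens (f x))"
proof -
  \<comment> \<open>With N the size of the input: at most one pending bit (code length at most 5),
    at most N digits, and at most N numbers of at most N digits each.\<close>
  let ?B = "\<lambda>N. Suc (Suc (5 + (4 * N + 1)) + (1 + N * (4 * N + 2)))"
  have "PT sz (\<lambda>x. foldl (\<lambda>s b. token_step s b) (([], []), []) x)"
  proof (rule PT_foldl[where Z = "\<lambda>x. ?B (sz x)"])
    show "PT sz (\<lambda>p :: (((bool list \<times> bool list) \<times> nat list) \<times> bool) \<times> bool list. token_step (fst (fst p)) (snd (fst p)))"
      unfolding token_step_def by (intro PT_intros)
    fix x ys zs :: "bool list" assume "x = ys @ zs"
    then have N: "length ys \<le> sz x" using sz_bools(2)[of x] by simp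
    have "sz (fst (fst s)) \<le> 5 \<and> length (snd (fst s)) \<le> length ys \<and> sz (snd s) \<le> 1 + length ys * (4 * sz x + 2)"
      if "s = foldl token_step (([], []), []) ys" for s
      using N that
    proof (induction ys arbitrary: s rule: rev_induct)
      case (snoc y ys)
      define s' where "s' = foldl token_step (([], []), []) ys"
      have IH: "sz (fst (fst s')) \<le> 5" "length (snd (fst s')) \<le> length ys" "sz (snd s') \<le> 1 + length ys * (4 * sz x + 2)"
        using snoc.IH[OF _ s'_def] snoc.prems(1) by auto
      have "from_digits 0 (snd (fst s')) < 2 ^ (0 + length (snd (fst s')))" by (rule from_digits_bound) simp
      from sz_less_pow[OF this] have "sz (from_digits 0 (snd (fst s'))) \<le> 4 * sz x + 1"
        using IH(2) snoc.prems(1) by simp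
      moreover have "s = token_step s' y" using snoc.prems(2) by (simp add: s'_def)
      ultimately show ?case using IH sz_bool[of y] by (auto simp: token_step_def split: list.split)
    qed simp
    from this[OF refl] obtain h c out where s: "foldl token_step (([], []), []) ys = ((h, c), out)"
      "sz h \<le> 5" "length c \<le> length ys" "sz out \<le> 1 + length ys * (4 * sz x + 2)"
      by (metis prod.collapse)
    have "length ys * (4 * sz x + 2) \<le> sz x * (4 * sz x + 2)" using N by (rule mult_right_mono) simp
    then show "sz (foldl (\<lambda>s b. token_step s b) (([], []), []) ys) \<le> ?B (sz x)"
      using s N sz_bools(1)[of c] by simp
  qed (intro PT_intros pb_intros)+
  then have "PT sz tokens" unfolding tokens_def by (intro PT_intros)
  then show ?thesis using assms by (rule PT_comp)
qed

text \<open>A raw gate \<open>(n, c, a, b)\<close> stands for the gate with name \<open>n\<close> and label code \<open>c\<close>;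
  it is an input gate with value \<open>a\<close> if \<open>c = 6\<close>, and has the predecessors \<open>a\<close> and \<open>b\<close> otherwise.\<close>

type_synonym raw_gate = "nat \<times> nat \<times> nat \<times> nat"

text \<open>The constants 0 and 2 directly before the predecessors are the list lengths that
  \<open>enc_gate\<close> writes; 6 marks an input label.\<close>

definition gate_tokens :: "raw_gate \<Rightarrow> nat list" where
  "gate_tokens g = (if fst (snd g) = 6 then [fst g, 6, fst (snd (snd g)), 0]
     else [fst g, fst (snd g), 2, fst (snd (snd g)), snd (snd (snd g))])"

definition gates_tokens :: "raw_gate list \<Rightarrow> nat list" where
  "gates_tokens gs = concat (map gate_tokens gs)"

lemma gates_tokens_simps [simp]:
  "gates_tokens [] = []" "gates_tokens (g # gs) = gate_tokens g @ gates_tokens gs"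
  by (simp_all add: gates_tokens_def)

lemma PT_gates_tokens [PT_intros]:
  assumes "PT M f"
  shows "PT M (\<lambda>x. gates_tokens (f x))"
proof -
  define c where "c = sz (6 :: nat) + sz (2 :: nat) + 10"
  have g: "sz (gate_tokens g) \<le> sz g + c" for g
    by (cases g) (simp add: gate_tokens_def c_def)
  have len: "sz (gates_tokens gs) \<le> sz gs * (c + 1)" for gs
  proof (induction gs)
    case (Cons y gs)
    then show ?case using g[of y] sz_append[of "gate_tokens y" "gates_tokens gs"] by (simp add: algebra_simps)
  qed simp
  have "PT M (\<lambda>x. (\<lambda>(_ :: 'a) gs. gates_tokens gs) x (f x))"
  proof (rule PT_list_rec[where F = "\<lambda>(_ :: 'a) gs. gates_tokens gs" and e = "\<lambda>x. x" and i = "\<lambda>e. []" and b = "\<lambda>y ys r e. gate_tokens y @ r" and Z = "\<lambda>x. sz (f x) * (c + 1)"])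
    show "PT sz (\<lambda>p :: ((raw_gate \<times> raw_gate list) \<times> nat list) \<times> 'a. gate_tokens (fst (fst (fst p))) @ snd (fst p))"
      unfolding gate_tokens_def by (intro PT_intros)
    fix x ys zs assume "f x = ys @ zs"
    then have "sz zs * (c + 1) \<le> sz (f x) * (c + 1)" using sz_append_ge(2)[of zs ys] by (intro mult_right_mono) simp_all
    then show "sz (gates_tokens zs) \<le> sz (f x) * (c + 1)" using len[of zs] by simp
  qed (intro PT_intros pb_intros PT_size assms PT_id[OF PT_dom[OF assms]] | simp)+
  then show ?thesis .
qed

text \<open>The predecessor count is skipped unchecked; re-encoding exposes a wrong one. A single
  remaining token is the queried number and makes the step idle.\<close>

definition parse_step :: "nat list \<times> raw_gate list \<Rightarrow> nat list \<times> raw_gate list" where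
  "parse_step s = (let ts = fst s; us = tl (tl ts) in
     if tl ts = [] then s
     else if hd0 (tl ts) = 6 then (tl (tl us), (hd0 ts, 6, hd0 us, 0) # snd s)
     else (tl (tl (tl us)), (hd0 ts, hd0 (tl ts), hd0 (tl us), hd0 (tl (tl us))) # snd s))"

text \<open>The token list itself is the fuel: every gate uses several tokens, so there are enough
  rounds, and surplus rounds are idle.\<close>

definition parse :: "nat list \<Rightarrow> nat list \<times> raw_gate list" where
  "parse ts = foldl (\<lambda>s _. parse_step s) (ts, []) ts"

text \<open>The last component of an input gate leaves no trace among the tokens, so the parser
  fills in 0 and recovers only gates normalised in this way.\<close>

lemma parse_gates_tokens:
  assumes "\<And>g. g \<in> set gs \<Longrightarrow> fst (snd g) = 6 \<Longrightarrow> snd (snd (snd g)) = 0"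
  shows "parse (gates_tokens gs @ [b]) = ([b], rev gs)"
proof -
  have iter: "foldl (\<lambda>s _. parse_step s) (gates_tokens gs @ [b], out) fuel = ([b], rev gs @ out)"
    if "length gs \<le> length fuel" "\<forall>g \<in> set gs. fst (snd g) = 6 \<longrightarrow> snd (snd (snd g)) = 0"
    for fuel :: "nat list" and out gs
    using that
  proof (induction fuel arbitrary: gs out)
    case (Cons u fuel)
    show ?case
    proof (cases gs)
      case Nil
      then show ?thesis using Cons.IH[of "[]" out] by (simp add: parse_step_def)
    next
      case (Cons g gs')
      have "parse_step (gates_tokens gs @ [b], out) = (gates_tokens gs' @ [b], g # out)"
        using Cons.prems(2) Cons by (cases g) (auto simp: parse_step_def gate_tokens_def Let_def)
      then show ?thesis using Cons.IH[of gs' "g # out"] Cons.prems Cons by simp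
    qed
  qed simp
  have "length gs \<le> length (gates_tokens gs @ [b])"
    by (induction gs) (auto simp: gate_tokens_def)
  from iter[OF this] show ?thesis using assms unfolding parse_def by simp
qed

lemma PT_parse [PT_intros]:
  assumes "PT M f"
  shows "PT M (\<lambda>x. parse (f x))"
proof -
  define c where "c = sz (6 :: nat) + 5"
  let ?B = "\<lambda>N. Suc (N + (1 + N * (4 * N + c)))"
  have step: "sz (fst (parse_step s)) \<le> N \<and> sz (snd (parse_step s)) \<le> sz (snd s) + (4 * N + c)"
    if s: "sz (fst s) \<le> N" for s N
  proof -
    have l: "sz (tl l) \<le> N" "sz (hd0 l) \<le> N" if "sz l \<le> N" for l
      using that sz_tl[of l] sz_hd0[of l] by simp_all
    note t1 = l[OF s] note t2 = l[OF t1(1)] note t3 = l[OF t2(1)] note t4 = l[OF t3(1)]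
    show ?thesis using s t1 t2 t3 t4 l[OF t4(1)] by (auto simp: parse_step_def Let_def c_def)
  qed
  have "PT sz (\<lambda>ts. foldl (\<lambda>s (_ :: nat). parse_step s) (ts, []) ts)"
  proof (rule PT_foldl[where Z = "\<lambda>x. ?B (sz x)"])
    show "PT sz (\<lambda>p :: ((nat list \<times> raw_gate list) \<times> nat) \<times> nat list. parse_step (fst (fst p)))"
      unfolding parse_step_def Let_def by (intro PT_intros)
    fix x ys zs :: "nat list" assume x: "x = ys @ zs"
    have "length ys \<le> sz ys" by (induction ys) auto
    then have N: "length ys \<le> sz x" using sz_append_ge(1)[of ys zs] by (simp add: x)
    have "sz (fst s) \<le> sz x \<and> sz (snd s) \<le> 1 + length ys * (4 * sz x + c)"
      if "s = foldl (\<lambda>s _. parse_step s) (x, []) ys" for s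
      using that
    proof (induction ys arbitrary: s rule: rev_induct)
      case (snoc y ys)
      define s' where "s' = foldl (\<lambda>s _. parse_step s) (x, []) ys"
      have IH: "sz (fst s') \<le> sz x" "sz (snd s') \<le> 1 + length ys * (4 * sz x + c)" using snoc.IH[OF s'_def] by auto
      have "s = parse_step s'" using snoc.prems by (simp add: s'_def)
      then show ?case using IH step[OF IH(1)] by (simp add: algebra_simps)
    qed simp
    moreover have "length ys * (4 * sz x + c) \<le> sz x * (4 * sz x + c)" using N by (rule mult_right_mono) simp
    ultimately have "sz (fst (foldl (\<lambda>s _. parse_step s) (x, []) ys)) \<le> sz x"
      "sz (snd (foldl (\<lambda>s _. parse_step s) (x, []) ys)) \<le> 1 + sz x * (4 * sz x + c)"
      by (auto intro: order_trans)
    then show "sz (foldl (\<lambda>s _. parse_step s) (x, []) ys) \<le> ?B (sz x)" by (simp add: sz_pair)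
  qed (intro PT_intros pb_intros)+
  then have "PT sz parse" unfolding parse_def .
  then show ?thesis using assms by (rule PT_comp)
qed

section \<open>Evaluation of circuits\<close>

text \<open>All results are empty or singletons; they are represented by lists of length at most one.\<close>

type_synonym table = "(nat \<times> nat list) list"

primrec has :: "nat \<Rightarrow> table \<Rightarrow> bool" where
  "has p [] = False"
| "has p (e # T) = (p = fst e \<or> has p T)"

primrec look :: "nat \<Rightarrow> table \<Rightarrow> nat list" where
  "look p [] = []"
| "look p (e # T) = (if p = fst e then snd e else look p T)"

definition allowed :: "bool \<Rightarrow> nat \<Rightarrow> bool" where
  "allowed mul c = (c = 1 \<or> c = 3 \<or> c = 5 \<or> mul \<and> c = 4)"

text \<open>The exact quotient is phrased with the very pair from \<open>PT_divmod\<close>, so that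
  this rule matches the definition as it stands.\<close>

definition op_value :: "nat \<Rightarrow> nat list \<Rightarrow> nat list \<Rightarrow> nat list" where
  "op_value c A B = (case A of [] \<Rightarrow> [] | v # _ \<Rightarrow> (case B of [] \<Rightarrow> [] | w # _ \<Rightarrow>
     if c = 1 then (if v = w then [v] else [])
     else if c = 3 then [v + w]
     else if c = 4 then [v * w]
     else if \<not> w = 0 \<and> snd (if w = 0 then (0, 0) else (v div w, v mod w)) = 0
       then [fst (if w = 0 then (0, 0) else (v div w, v mod w))] else []))"

definition gate_value :: "bool \<Rightarrow> raw_gate \<Rightarrow> table \<Rightarrow> nat list" where
  "gate_value mul g T = (if fst (snd g) = 6 then [fst (snd (snd g))]
     else if allowed mul (fst (snd g)) then op_value (fst (snd g)) (look (fst (snd (snd g))) T) (look (snd (snd (snd g))) T)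
     else [])"

definition gate_valid :: "bool \<Rightarrow> raw_gate \<Rightarrow> table \<Rightarrow> bool" where
  "gate_valid mul g T = (\<not> has (fst g) T \<and> (fst (snd g) = 6 \<or> allowed mul (fst (snd g)) \<and>
     fst (snd (snd g)) \<le> snd (snd (snd g)) \<and> has (fst (snd (snd g))) T \<and> has (snd (snd (snd g))) T))"

text \<open>Every gate precedes its predecessors in the list, so their names and values are found in
  the table of the tail.\<close>

primrec eval :: "bool \<Rightarrow> raw_gate list \<Rightarrow> table \<times> bool" where
  "eval mul [] = ([], True)"
| "eval mul (g # gs) = ((fst g, gate_value mul g (fst (eval mul gs))) # fst (eval mul gs),
     snd (eval mul gs) \<and> gate_valid mul g (fst (eval mul gs)))"

definition nat_in_list :: "nat \<Rightarrow> nat list \<Rightarrow> bool" where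
  "nat_in_list b vs = (case vs of [] \<Rightarrow> False | v # _ \<Rightarrow> v = b)"

definition gates_of :: "bool list \<Rightarrow> raw_gate list" where
  "gates_of x = rev (snd (parse (tl (tl (tokens x)))))"

definition number_of :: "bool list \<Rightarrow> nat" where
  "number_of x = hd0 (fst (parse (tl (tl (tokens x)))))"

definition well_encoded :: "bool list \<Rightarrow> bool" where
  "well_encoded x = (enc_nats (hd0 (tokens x) # length (gates_of x) # gates_tokens (gates_of x) @ [number_of x]) = x)"

text \<open>Only gates of a correctly encoded circuit are evaluated, because their total bit length is at most the
  length of the input; a polynomial bound would not suffice for exponential time \<open>2^O(n)\<close>.\<close>

definition guarded_gates :: "bool list \<Rightarrow> raw_gate list" where
  "guarded_gates x = (if well_encoded x then gates_of x else [])"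

definition decide :: "bool \<Rightarrow> bool list \<Rightarrow> bool" where
  "decide mul x = (well_encoded x \<and> snd (eval mul (guarded_gates x)) \<and> has (hd0 (tokens x)) (fst (eval mul (guarded_gates x))) \<and>
     nat_in_list (number_of x) (look (hd0 (tokens x)) (fst (eval mul (guarded_gates x)))))"

subsection \<open>Correctness\<close>

definition operations :: "bool \<Rightarrow> op set" where
  "operations mul = (if mul then {OInter, OPlus, OTimes, ODiv} else {OInter, OPlus, ODiv})"

definition op_of :: "nat \<Rightarrow> op" where
  "op_of c = (if c = 1 then OInter else if c = 3 then OPlus else if c = 4 then OTimes else ODiv)"

definition gate_of :: "raw_gate \<Rightarrow> gate" where
  "gate_of g = (case g of (n, c, a, b) \<Rightarrow> if c = 6 then (n, LInput a, []) else (n, LOp (op_of c), [a, b]))"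

lemma gate_of_eq: "gate_of (n, c, a, b) = (if c = 6 then (n, LInput a, []) else (n, LOp (op_of c), [a, b]))"
  by (simp add: gate_of_def)

lemma fst_gate_of [simp]: "fst (gate_of g) = fst g"
  by (cases g) (auto simp: gate_of_def)

lemma has_iff: "has p T \<longleftrightarrow> p \<in> fst ` set T"
  by (induction T) auto

lemma eval_names: "fst ` set (fst (eval mul gs)) = fst ` set gs"
  by (induction gs) auto

lemma gate_names_map: "gate_names (map gate_of gs) = map fst gs"
  by (simp add: gate_names_def)

lemma gate_names_Cons: "gate_names (g # gs) = fst g # gate_names gs"
  by (simp add: gate_names_def)

lemma allowed_op_of: "allowed mul c \<Longrightarrow> op_of c \<in> operations mul \<and> arity (op_of c) = 2 \<and> op_code (op_of c) = c"
  by (auto simp: allowed_def op_of_def operations_def)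

text \<open>\<open>op_of\<close> reads any unknown code as \<open>ODiv\<close>, so after translation
  by \<open>gate_of\<close> a wrong code would go unnoticed; this condition excludes it.\<close>

definition valid_code :: "bool \<Rightarrow> raw_gate \<Rightarrow> bool" where
  "valid_code mul g = (fst (snd g) = 6 \<or> allowed mul (fst (snd g)))"

lemma eval_valid:
  "snd (eval mul gs) \<longleftrightarrow> distinct (gate_names (map gate_of gs)) \<and> gates_ok (operations mul) (map gate_of gs)
     \<and> (\<forall>g \<in> set gs. valid_code mul g)"
proof (induction gs)
  case Nil
  show ?case by (simp add: gate_names_def)
next
  case (Cons g gs)
  obtain n c a b where g: "g = (n, c, a, b)" by (cases g) auto
  have "gate_valid mul g (fst (eval mul gs)) \<longleftrightarrow> n \<notin> fst ` set gs \<and> valid_code mul g \<and>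
    gate_ok (operations mul) (map gate_of gs) (gate_of g)"
    using allowed_op_of[of mul c]
    by (auto simp: gate_valid_def has_iff eval_names g gate_of_def valid_code_def gate_names_map allowed_def)
  then show ?case using Cons by (auto simp: gate_names_Cons gate_names_map g)
qed

lemma op_value_set:
  assumes "c = 1 \<or> c = 3 \<or> c = 4 \<or> c = 5" "length A \<le> 1" "length B \<le> 1"
  shows "set (op_value c A B) = gate_val (LOp (op_of c)) [set A, set B]"
proof -
  have "A = [] \<or> (\<exists>v. A = [v])" "B = [] \<or> (\<exists>w. B = [w])"
    using assms(2,3) by (auto simp: le_Suc_eq length_Suc_conv)
  moreover have "set_div_nat {v} {w} = (if w \<noteq> 0 \<and> v mod w = 0 then {v div w} else {})"
    "set_div_nat {} S = {}" "set_div_nat S {} = {}" for v w S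
    by (auto simp: set_div_nat_def)
  ultimately show ?thesis using assms(1) [[simproc del: list_to_set_comprehension]]
    by (auto simp: op_value_def op_of_def set_plus_nat_def set_times_nat_def split: if_splits)
qed

lemma length_op_value: "length (op_value c A B) \<le> 1"
  by (auto simp: op_value_def split: list.split)

lemma length_gate_value: "length (gate_value mul g T) \<le> 1"
  using length_op_value by (auto simp: gate_value_def)

lemma length_look: "length (look p (fst (eval mul gs))) \<le> 1"
  using length_gate_value by (induction gs) auto

lemma look_eval:
  "snd (eval mul gs) \<Longrightarrow> set (look p (fst (eval mul gs))) = gate_set (map gate_of gs) p"
proof (induction gs arbitrary: p)
  case (Cons g gs)
  obtain n c a b where g: "g = (n, c, a, b)" by (cases g) auto
  have "set (gate_value mul g (fst (eval mul gs))) = gate_val (LOp (op_of c)) [gate_set (map gate_of gs) a, gate_set (map gate_of gs) b]"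
    if "c \<noteq> 6"
  proof -
    have "allowed mul c" using Cons.prems that by (simp add: gate_valid_def g)
    then show ?thesis using that op_value_set[of c "look a (fst (eval mul gs))" "look b (fst (eval mul gs))", OF _ length_look length_look] Cons
      by (auto simp: gate_value_def g allowed_def)
  qed
  note op = this
  show ?case
  proof (cases "c = 6")
    case True
    then show ?thesis using Cons by (auto simp: g gate_of_eq gate_value_def)
  next
    case False
    then show ?thesis using Cons op by (auto simp: g gate_of_eq)
  qed
qed simp

lemma enc_gate_of: "valid_code mul g \<Longrightarrow> enc_gate (gate_of g) = enc_nats (gate_tokens g)"
  using allowed_op_of[of mul "fst (snd g)"]
  by (cases g) (auto simp: gate_of_def gate_tokens_def valid_code_def numeral_2_eq_2)

lemma enc_circuit_of:
  assumes "\<forall>g \<in> set gs. valid_code mul g"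
  shows "enc_circuit (map gate_of gs, n) @ enc_nat b = enc_nats (n # length gs # gates_tokens gs @ [b])"
proof -
  have "concat (map enc_gate (map gate_of gs)) = enc_nats (gates_tokens gs)"
    using assms by (induction gs) (auto simp: enc_gate_of)
  then show ?thesis by (simp add: enc_circuit_def)
qed

text \<open>All operations in question are binary, so four numbers describe a gate. Choosing 0 as
  the last component of input gates meets the hypothesis of
  \<open>parse_gates_tokens\<close>.\<close>

lemma gates_ok_raw:
  assumes "gates_ok (operations mul) gs"
  shows "\<exists>rs. gs = map gate_of rs \<and> (\<forall>r \<in> set rs. valid_code mul r \<and> (fst (snd r) = 6 \<longrightarrow> snd (snd (snd r)) = 0))"
  using assms
proof (induction gs)
  case (Cons g gs)
  then obtain rs where rs: "gs = map gate_of rs" "\<forall>r \<in> set rs. valid_code mul r \<and> (fst (snd r) = 6 \<longrightarrow> snd (snd (snd r)) = 0)"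
    by auto
  obtain n l ps where g: "g = (n, l, ps)" by (cases g) auto
  have "\<exists>r. g = gate_of r \<and> valid_code mul r \<and> (fst (snd r) = 6 \<longrightarrow> snd (snd (snd r)) = 0)"
  proof (cases l)
    case (LInput k)
    then show ?thesis using Cons.prems g by (intro exI[of _ "(n, 6, k, 0)"]) (auto simp: gate_of_def valid_code_def)
  next
    case (LOp f)
    then have f: "f \<in> operations mul" "length ps = arity f" using Cons.prems g by auto
    then have c: "op_of (op_code f) = f" "allowed mul (op_code f)" "arity f = 2"
      by (auto simp: operations_def op_of_def allowed_def split: if_splits)
    then obtain a b where "ps = [a, b]" using f(2) by (auto simp: numeral_2_eq_2 length_Suc_conv)
    then show ?thesis using c g LOp
      by (intro exI[of _ "(n, op_code f, a, b)"]) (auto simp: gate_of_def valid_code_def allowed_def)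
  qed
  then obtain r where "g = gate_of r" "valid_code mul r" "fst (snd r) = 6 \<longrightarrow> snd (snd (snd r)) = 0" by blast
  with rs show ?case by (intro exI[of _ "r # rs"]) auto
qed simp

lemma nat_in_list: "length vs \<le> 1 \<Longrightarrow> nat_in_list b vs \<longleftrightarrow> b \<in> set vs"
  by (cases vs) (auto simp: nat_in_list_def)

text \<open>Acceptance includes that re-encoding gives back \<open>x\<close>, which exhibits a
  circuit and a number whatever the parser did. Conversely, on a genuine encoding the parser
  recovers both.\<close>

lemma decide_correct: "decide mul x \<longleftrightarrow> x \<in> MC (operations mul)"
proof
  assume "decide mul x"
  then have w: "well_encoded x" and g: "guarded_gates x = gates_of x" by (auto simp: decide_def guarded_gates_def)
  let ?gs = "gates_of x" and ?n = "hd0 (tokens x)" and ?b = "number_of x"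
  have d: "snd (eval mul ?gs)" "has ?n (fst (eval mul ?gs))" "?b \<in> set (look ?n (fst (eval mul ?gs)))"
    using \<open>decide mul x\<close> by (simp_all add: decide_def g nat_in_list[OF length_look])
  then have v: "\<forall>g \<in> set ?gs. valid_code mul g" by (simp add: eval_valid)
  have "x = enc_circuit (map gate_of ?gs, ?n) @ enc_nat ?b"
    unfolding enc_circuit_of[OF v] using w by (simp add: well_encoded_def)
  moreover have "is_circuit (operations mul) (map gate_of ?gs, ?n)"
    using d by (simp add: is_circuit_def eval_valid has_iff eval_names gate_names_map)
  moreover have "?b \<in> circuit_set (map gate_of ?gs, ?n)"
    using d look_eval by (simp add: circuit_set_def)
  ultimately show "x \<in> MC (operations mul)" unfolding MC_def by blast
next
  assume "x \<in> MC (operations mul)"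
  then obtain gs n b where x: "x = enc_circuit (gs, n) @ enc_nat b" and c: "is_circuit (operations mul) (gs, n)"
    and b: "b \<in> circuit_set (gs, n)" unfolding MC_def by auto
  obtain rs where gs: "gs = map gate_of rs" and rs: "\<forall>r \<in> set rs. valid_code mul r \<and> (fst (snd r) = 6 \<longrightarrow> snd (snd (snd r)) = 0)"
    using gates_ok_raw c unfolding is_circuit_def by auto
  have enc: "x = enc_nats (n # length rs # gates_tokens rs @ [b])"
    unfolding x gs using rs by (intro enc_circuit_of) auto
  have "parse (tl (tl (tokens x))) = ([b], rev rs)"
    unfolding enc tokens_enc_nats using rs by (simp add: parse_gates_tokens)
  then have r: "gates_of x = rs" "number_of x = b" "hd0 (tokens x) = n"
    unfolding gates_of_def number_of_def by (simp_all add: enc tokens_enc_nats del: enc_nats_simps)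
  have w: "well_encoded x" unfolding well_encoded_def r using enc by simp
  have ev: "snd (eval mul rs)" using c rs by (simp add: eval_valid is_circuit_def gs)
  show "decide mul x"
    using w ev c b look_eval[OF ev, of n]
    by (simp add: decide_def guarded_gates_def r nat_in_list[OF length_look] is_circuit_def circuit_set_def gs
        has_iff eval_names gate_names_map)
qed


subsection \<open>Running time\<close>

text \<open>A potential for the growth of values: one unit per gate, plus the bits of the third
  component, which for an input gate is its label.\<close>

fun gates_weight :: "raw_gate list \<Rightarrow> nat" where
  "gates_weight [] = 0"
| "gates_weight (g # gs) = Suc (nlen (fst (snd (snd g))) + gates_weight gs)"

lemma gates_weight_append: "gates_weight (xs @ ys) = gates_weight xs + gates_weight ys"
  by (induction xs) auto

lemma length_enc_gates_tokens: "gates_weight gs \<le> length (enc_nats (gates_tokens gs))"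
proof (induction gs)
  case (Cons g gs)
  have "Suc (nlen (fst (snd (snd g)))) \<le> length (enc_nats (gate_tokens g))"
    by (simp add: gate_tokens_def length_enc_nat)
  then show ?case using Cons by simp
qed simp

text \<open>The tokens of the gates are part of the re-encoded string, which the guard forces to
  equal \<open>x\<close>.\<close>

lemma gates_weight_guarded: "gates_weight (guarded_gates x) \<le> length x"
proof (cases "well_encoded x")
  case True
  then have "length (enc_nats (gates_tokens (gates_of x))) \<le> length x"
    unfolding well_encoded_def by (metis (no_types, lifting) enc_nats_simps(2,3) length_append le_add1 le_add2 order_trans)
  then show ?thesis using length_enc_gates_tokens[of "gates_of x"] True by (simp add: guarded_gates_def)
qed (simp add: guarded_gates_def)

lemma look_in_table: "v \<in> set (look p T) \<Longrightarrow> \<exists>e \<in> set T. v \<in> set (snd e)"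
  by (induction T) (auto split: if_splits)

lemma op_value_bound:
  fixes N :: nat
  assumes "\<And>v. v \<in> set A \<Longrightarrow> v < N" "\<And>v. v \<in> set B \<Longrightarrow> v < N" "v \<in> set (op_value c A B)"
  shows "v < (if c = 4 then N * N else 2 * N)"
proof -
  obtain a A' b B' where AB: "A = a # A'" "B = b # B'" using assms(3)
    by (cases A; cases B) (auto simp: op_value_def)
  then have ab: "a < N" "b < N" using assms(1,2) by auto
  have "a div b \<le> a" by simp
  then have d: "a div b < 2 * N" using ab by linarith
  have "a * b < N * N" using ab by (intro mult_strict_mono') auto
  then show ?thesis using assms(3) ab d unfolding AB
    by (auto simp: op_value_def split: if_splits)
qed

text \<open>\<open>B\<close> turns weight into bit length: addition may cost one more bit,
  multiplication doubles the bits, and an input label has fewer bits than the weight of its gate.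
  Intersection and exact division never enlarge a value.\<close>

lemma eval_bound:
  assumes B: "\<And>m. Suc (B m) \<le> B (Suc m)" "\<And>m. mul \<Longrightarrow> 2 * B m \<le> B (Suc m)" "\<And>m. m \<le> B m"
  shows "e \<in> set (fst (eval mul gs)) \<Longrightarrow> v \<in> set (snd e) \<Longrightarrow> v < 2 ^ B (gates_weight gs)"
proof (induction gs arbitrary: e v)
  case (Cons g gs)
  let ?w = "gates_weight gs" and ?w' = "gates_weight (g # gs)"
  have "mono B" using B(1) by (intro mono_iff_le_Suc[THEN iffD2]) (meson Suc_leD)
  then have w: "B (Suc ?w) \<le> B ?w'" by (intro monoD[of B]) auto
  have look: "u < 2 ^ B ?w" if "u \<in> set (look p (fst (eval mul gs)))" for u p
    using look_in_table[OF that] Cons.IH by blast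
  have new: "u < 2 ^ B ?w'" if u: "u \<in> set (gate_value mul g (fst (eval mul gs)))" for u
  proof (cases "fst (snd g) = 6")
    case True
    then have "u = fst (snd (snd g))" using u by (simp add: gate_value_def)
    then have "u < 2 ^ nlen (fst (snd (snd g)))" using less_pow_nlen by simp
    also have "\<dots> \<le> 2 ^ B ?w'" using B(3)[of ?w'] by (intro power_increasing) auto
    finally show ?thesis .
  next
    case False
    let ?c = "fst (snd g)"
    have c: "allowed mul ?c" "u \<in> set (op_value ?c (look (fst (snd (snd g))) (fst (eval mul gs))) (look (snd (snd (snd g))) (fst (eval mul gs))))"
      using u False by (auto simp: gate_value_def split: if_splits)
    have "u < (if ?c = 4 then 2 ^ B ?w * 2 ^ B ?w else 2 * 2 ^ B ?w)"
      by (rule op_value_bound[OF look look c(2)])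
    also have "\<dots> \<le> 2 ^ B (Suc ?w)"
    proof (cases "?c = 4")
      case True
      then have "2 * B ?w \<le> B (Suc ?w)" using c(1) B(2) by (simp add: allowed_def)
      then have "(2::nat) ^ (2 * B ?w) \<le> 2 ^ B (Suc ?w)" by (intro power_increasing) auto
      then show ?thesis using True by (simp add: power_mult mult.commute[of 2] power2_eq_square)
    next
      case False
      have "(2::nat) ^ Suc (B ?w) \<le> 2 ^ B (Suc ?w)" using B(1) by (intro power_increasing) auto
      then show ?thesis using False by simp
    qed
    also have "\<dots> \<le> 2 ^ B ?w'" using w by (intro power_increasing) auto
    finally show ?thesis .
  qed
  have "(2::nat) ^ B ?w \<le> 2 ^ B ?w'" using w B(1)[of ?w] by (intro power_increasing) auto
  then have "v < 2 ^ B ?w'" if "v < 2 ^ B ?w" using that by (rule order_less_le_trans[rotated])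
  then show ?case using Cons.prems new Cons.IH[of e v] by auto
qed simp

lemma sz_table:
  assumes "\<And>e. e \<in> set (fst (eval mul gs)) \<Longrightarrow> sz (snd e) \<le> K"
  shows "sz (fst (eval mul gs)) \<le> sz gs * (K + 2)"
  using assms
proof (induction gs)
  case (Cons g gs)
  let ?vs = "gate_value mul g (fst (eval mul gs))"
  have "sz (fst g) \<le> sz g * (K + 2)" by (cases g) (simp add: algebra_simps)
  moreover have "sz ?vs \<le> K" using Cons.prems[of "(fst g, ?vs)"] by simp
  ultimately show ?case using Cons by (simp add: algebra_simps)
qed simp

lemma PT_has [PT_intros]:
  assumes "PT M f" "PT M T"
  shows "PT M (\<lambda>x. has (f x) (T x))"
proof -
  have "PT M (\<lambda>x. has (f x) (T x))"
    by (rule PT_list_rec[where F = has and e = f and l = T and i = "\<lambda>_. False" and b = "\<lambda>y ys r p. p = fst y \<or> r" and Z = "\<lambda>_. 3"])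
       (intro PT_intros pb_intros assms sz_bool | simp)+
  then show ?thesis .
qed

lemma sz_look: "sz (look p T) \<le> sz T"
  by (induction T) (auto simp: sz_pair)

lemma PT_look [PT_intros]:
  assumes "PT M f" "PT M T"
  shows "PT M (\<lambda>x. look (f x) (T x))"
proof (rule PT_list_rec[where F = look and e = f and l = T and i = "\<lambda>_. []" and b = "\<lambda>y ys r p. if p = fst y then snd y else r" and Z = "\<lambda>x. sz (T x)"])
  fix x ys zs assume "T x = ys @ zs"
  then show "sz (look (f x) zs) \<le> sz (T x)" using sz_look[of "f x" zs] sz_append_ge(2)[of zs ys] by simp
qed (intro PT_intros pb_intros PT_size assms | simp)+

lemma PT_op_value: "PT sz (\<lambda>p. op_value (fst (fst p)) (snd (fst p)) (snd p))"
  unfolding op_value_def by (intro PT_intros PT_divmod)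

lemma PT_gate_value: "PT sz (\<lambda>p. gate_value mul (fst p) (snd p))"
  unfolding gate_value_def allowed_def by (intro PT_intros PT_comp3[OF PT_op_value])

lemma PT_gate_valid: "PT sz (\<lambda>p. gate_valid mul (fst p) (snd p))"
  unfolding gate_valid_def allowed_def by (intro PT_intros)

text \<open>The recursion needs bounds for the tables of all suffixes of the gate list; a suffix
  weighs no more than the list, and \<open>B\<close> is monotone.\<close>

lemma PT_eval:
  assumes f: "PT M f" and Z: "poly_bounded M (\<lambda>x. B (gates_weight (f x)))"
    and B: "\<And>m. Suc (B m) \<le> B (Suc m)" "\<And>m. mul \<Longrightarrow> 2 * B m \<le> B (Suc m)" "\<And>m. m \<le> B m"
  shows "PT M (\<lambda>x. eval mul (f x))"
proof -
  have mono: "mono B" using B(1) by (intro mono_iff_le_Suc[THEN iffD2]) (meson Suc_leD)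
  let ?K = "\<lambda>x. 4 * B (gates_weight (f x)) + 3"
  have "PT M (\<lambda>x. (\<lambda>(_ :: 'a) gs. eval mul gs) x (f x))"
  proof (rule PT_list_rec[where F = "\<lambda>(_ :: 'a) gs. eval mul gs" and e = "\<lambda>x. x" and i = "\<lambda>_. ([], True)" and
      b = "\<lambda>g gs r e. ((fst g, gate_value mul g (fst r)) # fst r, snd r \<and> gate_valid mul g (fst r))"
      and Z = "\<lambda>x. Suc (sz (f x) * (?K x + 2) + 3)"])
    show "PT sz (\<lambda>p :: ((raw_gate \<times> raw_gate list) \<times> table \<times> bool) \<times> 'a.
        ((fst (fst (fst (fst p))), gate_value mul (fst (fst (fst p))) (fst (snd (fst p)))) # fst (snd (fst p)),
         snd (snd (fst p)) \<and> gate_valid mul (fst (fst (fst p))) (fst (snd (fst p)))))"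
      by (intro PT_intros PT_comp2[OF PT_gate_value] PT_comp2[OF PT_gate_valid])
    show "poly_bounded M (\<lambda>x. Suc (sz (f x) * (?K x + 2) + 3))" by (intro pb_intros PT_size f Z)
    fix x ys zs assume fx: "f x = ys @ zs"
    have "sz (snd e) \<le> ?K x" if e: "e \<in> set (fst (eval mul zs))" for e
    proof -
      have len: "length (snd e) \<le> 1" using e length_gate_value by (induction zs) auto
      have "sz v \<le> 4 * B (gates_weight zs) + 1" if "v \<in> set (snd e)" for v
        using eval_bound[OF B e that] by (rule sz_less_pow)
      moreover have "B (gates_weight zs) \<le> B (gates_weight (f x))"
        using mono by (intro monoD[of B]) (auto simp: fx gates_weight_append)
      ultimately show ?thesis using len by (cases "snd e") fastforce+
    qed
    then have "sz (fst (eval mul zs)) \<le> sz zs * (?K x + 2)" by (rule sz_table)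
    also have "\<dots> \<le> sz (f x) * (?K x + 2)" using sz_append_ge(2)[of zs ys] by (intro mult_right_mono) (simp_all add: fx)
    finally show "sz (eval mul zs) \<le> Suc (sz (f x) * (?K x + 2) + 3)"
      using sz_bool[of "snd (eval mul zs)"] by (simp add: sz_pair)
  qed (intro PT_intros f PT_id[OF PT_dom[OF f]] | simp)+
  then show ?thesis .
qed

text \<open>It suffices that \<open>M\<close> dominates \<open>B\<close> at \<open>length x\<close>
  itself rather than at a polynomial in it, because the guard keeps the weight of the gates at most
  \<open>length x\<close>.\<close>

lemma PT_decide:
  assumes M: "\<And>x. B (length x) + length x \<le> M x"
    and B: "\<And>m. Suc (B m) \<le> B (Suc m)" "\<And>m. mul \<Longrightarrow> 2 * B m \<le> B (Suc m)" "\<And>m. m \<le> B m"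
  shows "PT M (decide mul)"
proof -
  have mono: "mono B" using B(1) by (intro mono_iff_le_Suc[THEN iffD2]) (meson Suc_leD)
  have "sz x \<le> 4 * M x + 1" for x using sz_bools(1)[of x] M[of x] by simp
  then have id: "PT M (\<lambda>x. x)"
    by (intro PT_id) (rule pb_le[of _ "\<lambda>x. 4 * M x + 1"], intro pb_intros)
  note const = PT_const[OF PT_dom[OF id]]
  have g: "PT M guarded_gates"
    unfolding guarded_gates_def well_encoded_def gates_of_def number_of_def by (intro PT_intros id const)
  have "B (gates_weight (guarded_gates x)) \<le> M x" for x
    using monoD[OF mono gates_weight_guarded[of x]] M[of x] by simp
  then have "poly_bounded M (\<lambda>x. B (gates_weight (guarded_gates x)))"
    using pb_self by (blast intro: pb_le)
  note ev = PT_eval[OF g this B]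
  show ?thesis
    unfolding decide_def nat_in_list_def well_encoded_def gates_of_def number_of_def
    by (intro PT_intros id const ev)
qed

section \<open>From programs to complexity classes\<close>

text \<open>The first loop reverses the input onto \<open>R1\<close>, so that the list code grows
  from its last bit on top of \<open>Zero\<close>, the empty list: each bit adds \<open>One\<close>
  for the list cell and its own code. The input ends with an empty stack instead of a
  \<open>Hash\<close>, hence \<open>transfer\<close> and not \<open>pour\<close> for this
  loop.\<close>

definition read_input :: com where
  "read_input = Seq (Push R1 Hash) (Seq (transfer R0 (Push R1)) (Seq (Push R0 Zero)
     (pour R1 (\<lambda>a. if a = One then push_all [One, One, Zero, Zero] else push_all [One, Zero]))))"

lemma exec_read_input:
  "exec read_input (input_store x) (18 * length x + 20) (store3 (code (encd x)) [] [])"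
proof -
  let ?s = "\<lambda>b. if b then One else Zero"
  let ?w = "map ?s x"
  have s: "input_store x = store3 ?w [] []"
    by (auto simp: input_store_def store3_def fun_eq_iff split: reg.split)
  have 1: "exec (transfer R0 (Push R1)) (store3 ?w [Hash] []) (5 * length x + 1) (store3 [] (rev ?w @ [Hash]) [])"
    using exec_transfer[of "\<lambda>w d. store3 w (d @ [Hash]) []" R0 "[]" "Push R1" 1 ?w "[]"]
    by (auto simp: exec_Push3 simp del: One_nat_def)
  let ?f = "\<lambda>a. if a = One then push_all [One, One, Zero, Zero] else push_all [One, Zero]"
  let ?G = "\<lambda>w d. store3 (code (encd (map (\<lambda>a. a = One) d))) (w @ [Hash]) []"
  have "exec (pour R1 ?f) (?G (rev ?w) []) ((9 + 4) * length (rev ?w) + 3) ((?G [] (rev (rev ?w) @ []))(R1 := []))"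
  proof (rule exec_pour)
    fix a w d assume a: "a = One \<or> a = Zero"
    show "exec (?f a) ((?G (a # w) d)(R1 := w @ [Hash])) 9 (?G w (a # d))"
    proof (cases "a = One")
      case True
      show ?thesis using True
          exec_mono[OF exec_push_all[of "[One, One, Zero, Zero]" "code (encd (map (\<lambda>a. a = One) d))" "w @ [Hash]" "[]"], of 9]
        by (simp del: push_all.simps)
    next
      case False
      show ?thesis using False
          exec_mono[OF exec_push_all[of "[One, Zero]" "code (encd (map (\<lambda>a. a = One) d))" "w @ [Hash]" "[]"], of 9]
        by (simp del: push_all.simps)
    qed
  qed auto
  moreover have "map (\<lambda>a. a = One) ?w = x" by (simp add: comp_def)
  ultimately have 2: "exec (pour R1 ?f) (store3 [Zero] (rev ?w @ [Hash]) []) (13 * length x + 3) (store3 (code (encd x)) [] [])"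
    by simp
  show ?thesis unfolding read_input_def s
    by (rule exec_mono[OF exec_Seq[OF exec_Push3(2) exec_Seq[OF 1 exec_Seq[OF exec_Push3(1) 2]]]]) simp
qed

text \<open>Reading the input is linear and the simulation is quadratic; both vanish in the exponent
  \<open>k\<close>, since \<open>M n\<close> is at least \<open>n\<close>.\<close>

lemma DTIME_by_PT:
  assumes "PT (\<lambda>x. M (length x)) f" "\<And>n. n \<le> M n"
  shows "\<exists>k. {x. f x} \<in> DTIME (\<lambda>n. (M n + 2) ^ k)"
proof -
  obtain p T where pT: "poly_bounded (\<lambda>x. M (length x)) T"
    "\<And>x a b c. exec p (store3 (code (encd x) @ a) b c) (T x) (store3 (code (encd (f x)) @ a) b c)"
    using assms(1) by (rule PT_E) (rule that)
  obtain k where k: "\<And>x. T x \<le> (M (length x) + 2) ^ k" using pT(1) unfolding poly_bounded_def by blast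
  let ?T = "\<lambda>n. Suc ((18 * n + 20) + (M n + 2) ^ k)"
  have "\<exists>t s. runs (Seq read_input p) (input_store x) t s \<and> t \<le> ?T (length x) \<and> (top_of (s R0) = Some One \<longleftrightarrow> x \<in> {x. f x})" for x
  proof -
    have "exec (Seq read_input p) (input_store x) (Suc ((18 * length x + 20) + T x)) (store3 (code (encd (f x)) @ []) [] [])"
      using pT(2)[of x "[]" "[]" "[]"] by (intro exec_Seq[OF exec_read_input]) simp
    then have "exec (Seq read_input p) (input_store x) (?T (length x)) (store3 (code (encd (f x)) @ []) [] [])"
      using k[of x] by (elim exec_mono) simp
    then obtain t where "t \<le> ?T (length x)" "runs (Seq read_input p) (input_store x) t (store3 (code (encd (f x)) @ []) [] [])"
      unfolding exec_def by blast
    moreover have "top_of (store3 (code (encd (f x)) @ []) [] [] R0) = Some One \<longleftrightarrow> x \<in> {x. f x}"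
      unfolding store3_simps top_code by (simp add: encd_bool_def)
    ultimately show ?thesis by blast
  qed
  then have "{x. f x} \<in> DTIME (\<lambda>n. ?T n * (2 * (n + ?T n) + 3) + 2)" by (rule DTIME_by_program)
  moreover have "poly_bounded M (\<lambda>n. n)" using pb_self assms(2) by (rule pb_le)
  then have "poly_bounded M (\<lambda>n. ?T n * (2 * (n + ?T n) + 3) + 2)" by (intro pb_intros)
  then obtain j where "\<And>n. ?T n * (2 * (n + ?T n) + 3) + 2 \<le> (M n + 2) ^ j" unfolding poly_bounded_def by blast
  ultimately show ?thesis unfolding DTIME_def decides_within_def mem_Collect_eq by (meson order_trans)
qed

lemma DTIME_mono: "L \<in> DTIME T \<Longrightarrow> (\<And>n. T n \<le> U n) \<Longrightarrow> L \<in> DTIME U"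
  unfolding DTIME_def decides_within_def mem_Collect_eq by (meson order_trans)

theorem theorem2:
  shows "in_P (MC {OInter, OPlus, ODiv}) \<and> in_E (MC {OInter, OPlus, OTimes, ODiv})"
proof
  have MC: "{x. decide mul x} = MC (operations mul)" for mul
    using decide_correct by blast
  have "PT (\<lambda>x. length x + length x) (decide False)"
    by (rule PT_decide[where B = "\<lambda>m. m"]) auto
  then obtain k where "{x. decide False x} \<in> DTIME (\<lambda>n. (n + n + 2) ^ k)"
    using DTIME_by_PT[of "\<lambda>n. n + n" "decide False"] by auto
  \<comment> \<open>\<open>in_P\<close> uses one constant as factor and as exponent.
    \<open>2 ^ k\<close> can be both, because 2n + 2 = 2(n + 1) and k is at most 2^k.\<close>
  moreover have "(n + n + 2) ^ k \<le> 2 ^ k * (n + 1) ^ 2 ^ k" for n :: nat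
  proof -
    have "n + n + 2 = 2 * (n + 1)" by simp
    then have "(n + n + 2) ^ k = 2 ^ k * (n + 1) ^ k" by (simp only: power_mult_distrib)
    also have "\<dots> \<le> 2 ^ k * (n + 1) ^ 2 ^ k" by (intro mult_left_mono power_increasing) (auto simp: less_imp_le)
    finally show ?thesis .
  qed
  ultimately have "{x. decide False x} \<in> DTIME (\<lambda>n. 2 ^ k * (n + 1) ^ 2 ^ k)" by (rule DTIME_mono)
  then show "in_P (MC {OInter, OPlus, ODiv})"
    unfolding in_P_def MC operations_def by auto
next
  have MC: "{x. decide mul x} = MC (operations mul)" for mul
    using decide_correct by blast
  have "PT (\<lambda>x. 2 ^ length x + length x) (decide True)"
    by (rule PT_decide[where B = "\<lambda>m. 2 ^ m"]) (auto simp: less_imp_le)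
  then obtain k where "{x. decide True x} \<in> DTIME (\<lambda>n. (2 ^ n + n + 2) ^ k)"
    using DTIME_by_PT[of "\<lambda>n. 2 ^ n + n" "decide True"] by auto
  \<comment> \<open>The constant 2k for \<open>in_E\<close> arises from bounding the base by 2^(n +
    2) and hence by 2^(2(n + 1)).\<close>
  moreover have "(2 ^ n + n + 2) ^ k \<le> 2 ^ (2 * k * (n + 1))" for n :: nat
  proof -
    have "n < 2 ^ n" "(0::nat) < 2 ^ n" by simp_all
    then have "2 ^ n + n + 2 \<le> 4 * 2 ^ n" by linarith
    also have "\<dots> = 2 ^ (n + 2)" by simp
    also have "\<dots> \<le> 2 ^ (2 * (n + 1))" by (intro power_increasing) auto
    finally have "2 ^ n + n + 2 \<le> (2 :: nat) ^ (2 * (n + 1))" .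
    then have "(2 ^ n + n + 2) ^ k \<le> (2 ^ (2 * (n + 1))) ^ k" by (rule power_mono) simp
    also have "\<dots> = 2 ^ (2 * k * (n + 1))" by (simp only: power_mult[symmetric] ac_simps)
    finally show ?thesis .
  qed
  ultimately have "{x. decide True x} \<in> DTIME (\<lambda>n. 2 ^ (2 * k * (n + 1)))" by (rule DTIME_mono)
  then show "in_E (MC {OInter, OPlus, OTimes, ODiv})"
    unfolding in_E_def MC operations_def by auto
qed

end
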